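(* Let $k$ be a field. Let $$A=\frac{k[X,Z,V]}{(X^{n}V-f(X,Z))},$$ where $n\ge 2$, $f(X,Z)\in k[X,Z]$, $\deg_Z f(X,Z)\ge 2$ and $f(0,Z)\ne 0$. Let $$B=\frac{k[X,Y,Z,T]}{(X^{d}Y-P(X,Z),\;X^{e}T-Q(X,Y,Z))},$$ where $d,e$ are positive integers, $P(X,Z)\in k[X,Z]$ is monic in $Z$ with $\deg_Z P\ge 2$, and $Q(X,Y,Z)\in k[X,Y,Z]$ is monic in $Y$ with $\deg_Y Q\ge 2$. Then $A$ is not isomorphic to $B$ as a $k$-algebra.
   Context: In the paper's terminology, $A$ is (the coordinate ring of) a Danielewski surface and $B$ is (the coordinate ring of) a double Danielewski surface. *)

theory Defs
  imports "HOL-Algebra.Algebraic_Closure_Type"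
begin

section \<open>Quotient algebras and isomorphisms of algebras\<close>

text \<open>
  For a ring homomorphism \<open>\<iota>\<close> from a field \<open>k\<close> to a commutative ring \<open>R\<close> (both given as types), this
  is the \<open>k\<close>-algebra \<open>R / (S)\<close>, on which \<open>c\<close> in \<open>k\<close> acts as multiplication by the class of \<open>\<iota> c\<close>.
\<close>
definition quotient_algebra ::
    "('k::field \<Rightarrow> 'a::comm_ring_1) \<Rightarrow> 'a set \<Rightarrow> ('k, 'a set) module" where
  "quotient_algebra \<iota> S =
    (let R = ring_of_type_algebra; I = genideal R S; K = R Quot I in
     \<lparr> carrier = carrier K, monoid.mult = monoid.mult K, one = monoid.one K,
       ring.zero = ring.zero K, add = ring.add K,
       module.smult = (\<lambda>c x. (I +>\<^bsub>R\<^esub> \<iota> c) \<otimes>\<^bsub>K\<^esub> x) \<rparr>)"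

definition algebra_iso :: "_ \<Rightarrow> _ \<Rightarrow> _ \<Rightarrow> ('a \<Rightarrow> 'b) set" where
  "algebra_iso K A B =
    {\<phi> \<in> ring_iso A B. \<forall>c\<in>carrier K. \<forall>x\<in>carrier A. \<phi> (c \<odot>\<^bsub>A\<^esub> x) = c \<odot>\<^bsub>B\<^esub> \<phi> x}"

definition algebra_isomorphic :: "_ \<Rightarrow> _ \<Rightarrow> _ \<Rightarrow> bool" where
  "algebra_isomorphic K A B \<longleftrightarrow> algebra_iso K A B \<noteq> {}"

lemma quotient_algebra_is_algebra:
  fixes \<iota> :: "'k::field \<Rightarrow> 'a::comm_ring_1"
  assumes "\<iota> 1 = 1" "\<And>a b. \<iota> (a + b) = \<iota> a + \<iota> b" "\<And>a b. \<iota> (a * b) = \<iota> a * \<iota> b"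
  shows "algebra ring_of_type_algebra (quotient_algebra \<iota> S)"
proof -
  define R where "R = (ring_of_type_algebra :: 'a ring)"
  define I where "I = genideal R S"
  define K where "K = R Quot I"
  interpret R: cring R unfolding R_def by (rule cring_from_type_algebra)
  interpret ideal I R unfolding I_def
    by (rule R.genideal_ideal) (simp add: R_def ring_of_type_algebra_def)
  interpret K: cring K unfolding K_def by (rule quotient_is_cring) (rule R.is_cring)
  interpret k: cring "ring_of_type_algebra :: 'k ring" by (rule cring_from_type_algebra)
  define h where "h = (\<lambda>a. I +>\<^bsub>R\<^esub> a)"
  have h: "h \<in> ring_hom R K" unfolding h_def K_def by (rule rcos_ring_hom)
  have Rs: "carrier R = UNIV" "\<And>x y. x \<otimes>\<^bsub>R\<^esub> y = x * y" "\<And>x y. x \<oplus>\<^bsub>R\<^esub> y = x + y" "\<one>\<^bsub>R\<^esub> = 1"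
    by (simp_all add: R_def ring_of_type_algebra_def)
  have hc: "h a \<in> carrier K" for a using ring_hom_closed[OF h] Rs by auto
  have hp: "h (a + b) = h a \<oplus>\<^bsub>K\<^esub> h b" for a b using ring_hom_add[OF h, of a b] Rs by simp
  have ht: "h (a * b) = h a \<otimes>\<^bsub>K\<^esub> h b" for a b using ring_hom_mult[OF h, of a b] Rs by simp
  have h1: "h 1 = \<one>\<^bsub>K\<^esub>" using ring_hom_one[OF h] Rs by simp
  define M where "M = \<lparr> carrier = carrier K, monoid.mult = monoid.mult K, one = monoid.one K,
       ring.zero = ring.zero K, add = ring.add K, module.smult = (\<lambda>c x. h (\<iota> c) \<otimes>\<^bsub>K\<^esub> x) \<rparr>"
  have M: "quotient_algebra \<iota> S = M"
    by (simp add: quotient_algebra_def Let_def M_def K_def I_def R_def h_def)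
  have "cring M"
    by (intro cringI abelian_groupI comm_monoidI)
      (auto simp: M_def K.a_ac K.m_ac K.l_distr K.r_distr intro: K.l_neg)
  moreover have "carrier M = carrier K" "\<And>x y. x \<otimes>\<^bsub>M\<^esub> y = x \<otimes>\<^bsub>K\<^esub> y"
    "\<And>x y. x \<oplus>\<^bsub>M\<^esub> y = x \<oplus>\<^bsub>K\<^esub> y" "\<And>c x. c \<odot>\<^bsub>M\<^esub> x = h (\<iota> c) \<otimes>\<^bsub>K\<^esub> x"
    by (simp_all add: M_def)
  ultimately show ?thesis unfolding M
    by (intro algebraI k.is_cring)
      (simp_all add: assms ring_of_type_algebra_def hc hp ht h1 K.l_distr K.r_distr K.m_assoc)
qed


section \<open>Danielewski and double Danielewski surfaces\<close>

text \<open>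
  Polynomial rings in several variables are iterated univariate ones, the last variable being the
  outermost: \<open>k[X,Z] = k[X][Z]\<close>, \<open>k[X,Z,V] = k[X][Z][V]\<close>, \<open>k[X,Y,Z] = k[X][Z][Y]\<close> and
  \<open>k[X,Y,Z,T] = k[X][Z][Y][T]\<close>. Thus for \<open>P\<close> in \<open>k[X,Z]\<close>, \<^term>\<open>Polynomial.degree P\<close> and
  \<^term>\<open>lead_coeff P\<close> refer to the variable \<open>Z\<close>, and for \<open>Q\<close> in \<open>k[X,Y,Z]\<close> they refer to \<open>Y\<close>.
\<close>

text \<open>The variable \<open>X\<close> as an element of \<open>k[X,Z]\<close>.\<close>
abbreviation var_X :: "'k::field poly poly" where
  "var_X \<equiv> [:[:0, 1:]:]"

text \<open>The polynomial \<open>f(0,Z)\<close> in \<open>k[Z]\<close>, for \<open>f\<close> in \<open>k[X,Z]\<close>.\<close>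
definition at_X_0 :: "'k::field poly poly \<Rightarrow> 'k poly" where
  "at_X_0 f = map_poly (\<lambda>p. poly p 0) f"

text \<open>\<open>k[X,Z,V] / (X^n V - f)\<close>; here \<open>[:0, 1:]\<close> is \<open>V\<close>.\<close>
definition danielewski_algebra ::
    "nat \<Rightarrow> 'k::field poly poly \<Rightarrow> ('k, 'k poly poly poly set) module" where
  "danielewski_algebra n f =
    quotient_algebra (\<lambda>c. [:[:[:c:]:]:]) {[:var_X ^ n:] * [:0, 1:] - [:f:]}"

text \<open>
  \<open>k[X,Y,Z,T] / (X^d Y - P, X^e T - Q)\<close>; here \<open>[:0, 1:]\<close> is \<open>Y\<close> in \<open>k[X,Z][Y]\<close> in the first generator
  and \<open>T\<close> in \<open>k[X,Z,Y][T]\<close> in the second.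
\<close>
definition double_danielewski_algebra ::
    "nat \<Rightarrow> nat \<Rightarrow> 'k::field poly poly \<Rightarrow> 'k poly poly poly
      \<Rightarrow> ('k, 'k poly poly poly poly set) module" where
  "double_danielewski_algebra d e P Q =
    quotient_algebra (\<lambda>c. [:[:[:[:c:]:]:]:])
      {[:[:var_X ^ d:] * [:0, 1:] - [:P:]:], [:[:var_X ^ e:]:] * [:0, 1:] - [:Q:]}"

end

theory Submission
  imports Defs "HOL-Computational_Algebra.Formal_Laurent_Series"
begin

text \<open>
  Write \<open>A\<close> and \<open>B\<close> for the two algebras; \<open>A\<close> is a domain, so an isomorphism makes \<open>B\<close> the
  subring of \<open>k[Z]((X))\<close> generated by \<open>x\<close>, \<open>z\<close>, \<open>y = P / x ^ d\<close> and \<open>t = Q / x ^ e\<close>. Let \<open>a\<close>, \<open>b\<close>,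
  \<open>v\<close> be the images of \<open>X\<close>, \<open>Z\<close>, \<open>V\<close>, so that \<open>k[a, b]\<close> is contained in \<open>B\<close> and \<open>B\<close> in
  \<open>k[a, 1/a, b]\<close>. Assign to a series the order in \<open>X\<close> and the \<open>Z\<close>-degree of its lowest coefficient.
  On \<open>B\<close> these pairs form the monoid spanned by those of \<open>x\<close>, \<open>z\<close>, \<open>y\<close>, \<open>t\<close>, and dividing with
  remainder by a suitable element of \<open>k[a, b]\<close> shows that \<open>a - c\<close>, for some constant \<open>c\<close>, is
  divisible by \<open>x\<close>. If \<open>c \<noteq> 0\<close> then \<open>B / x B\<close> is generated by \<open>b\<close>; if \<open>c = 0\<close> then \<open>a\<close> is a constant
  multiple of \<open>x\<close> and \<open>B / x B\<close> is generated by \<open>z\<close> and \<open>v\<close>. Both are impossible, since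
  \<open>B / x B = S[Y, T] / (q)\<close> with \<open>S = k[Z] / (P(0, Z))\<close> and \<open>q\<close> monic in \<open>Y\<close> of degree at least \<open>2\<close>.
\<close>

text \<open>The pairs on \<open>B\<close> are computable because cancellation of lowest terms is
  under control: when a fraction \<open>u / X ^ e\<close> is adjoined, \<open>X ^ e\<close> and the
  lowest term of \<open>u\<close> behave like a regular sequence on lowest terms, so a cancelling
  presentation can be rewritten as one of higher order. The order in \<open>X\<close> alone would be
  too coarse, as it does not separate \<open>z\<close> from a constant; with the degree added, the
  pairs fill a plane cone in which \<open>a - c\<close> determines a line and a linear functional
  vanishing on it. Degree bounds enter through this cone: a functional vanishing at the pair of
  \<open>t\<close> has values at least 2 at \<open>x\<close>, \<open>z\<close> and \<open>y\<close>,
  so it cannot take the value 1. That \<open>B\<close> embeds into Laurent series is not read off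
  from its two relations. The kernel of the evaluation is killed by powers of \<open>x\<close>
  modulo the relations, and \<open>x\<close> corresponds under the isomorphism to a nonzero element
  of the domain \<open>A\<close>, so this torsion vanishes.\<close>

hide_const (open) UnivPoly.coeff UnivPoly.monom Polynomials.degree

notation fls_nth (infixl "$$" 75)

section \<open>Iterated evaluation homomorphisms\<close>

definition ring_map :: "('a::comm_ring_1 \<Rightarrow> 'b::comm_ring_1) \<Rightarrow> bool" where
  "ring_map h \<longleftrightarrow> h 1 = 1 \<and> (\<forall>a b. h (a + b) = h a + h b) \<and> (\<forall>a b. h (a * b) = h a * h b)"

context
  fixes h :: "'a::comm_ring_1 \<Rightarrow> 'b::comm_ring_1"
  assumes h: "ring_map h"
begin

lemma ring_map_1: "h 1 = 1"
  and ring_map_add: "h (a + b) = h a + h b"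
  and ring_map_mult: "h (a * b) = h a * h b"
  using h by (auto simp: ring_map_def)

lemma ring_map_0: "h 0 = 0"
  using ring_map_add[of 0 0] by simp

lemma ring_map_minus: "h (- a) = - h a"
  using ring_map_add[of a "- a"] by (simp add: ring_map_0 eq_neg_iff_add_eq_0 add.commute)

lemma ring_map_diff: "h (a - b) = h a - h b"
  using ring_map_add[of a "- b"] by (simp add: ring_map_minus)

lemma ring_map_power: "h (a ^ n) = h a ^ n"
  by (induction n) (simp_all add: ring_map_1 ring_map_mult)

lemma ring_map_sum: "h (sum f A) = (\<Sum>i\<in>A. h (f i))"
  by (induction A rule: infinite_finite_induct) (simp_all add: ring_map_0 ring_map_add)

lemmas ring_map_simps = ring_map_0 ring_map_1 ring_map_add ring_map_mult ring_map_minus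
  ring_map_diff ring_map_power ring_map_sum

end

text \<open>Iterating this extension, one variable at a time, gives the homomorphisms out of the
  nested polynomial rings.\<close>

definition poly_ev :: "('a::comm_ring_1 \<Rightarrow> 'b::comm_ring_1) \<Rightarrow> 'b \<Rightarrow> 'a poly \<Rightarrow> 'b" where
  "poly_ev h s p = poly (map_poly h p) s"

lemma poly_ev_pCons: "ring_map h \<Longrightarrow> poly_ev h s (pCons c p) = h c + s * poly_ev h s p"
  by (simp add: poly_ev_def map_poly_pCons ring_map_0)

lemma poly_ev_0: "poly_ev h s 0 = 0"
  by (simp add: poly_ev_def)

lemma poly_ev_const: "ring_map h \<Longrightarrow> poly_ev h s [:c:] = h c"
  by (simp add: poly_ev_pCons poly_ev_0)

lemma poly_ev_var: "ring_map h \<Longrightarrow> poly_ev h s [:0, 1:] = s"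
  by (simp add: poly_ev_pCons poly_ev_0 ring_map_simps)

lemma ring_map_poly_ev:
  assumes h: "ring_map h"
  shows "ring_map (poly_ev h s)"
proof -
  have add: "poly_ev h s (p + q) = poly_ev h s p + poly_ev h s q" for p q
    by (induction p q rule: poly_induct2)
      (simp_all add: poly_ev_pCons poly_ev_0 h ring_map_simps[OF h] algebra_simps)
  have smult: "poly_ev h s (smult c q) = h c * poly_ev h s q" for c q
    by (induction q) (simp_all add: poly_ev_pCons poly_ev_0 h ring_map_simps[OF h] algebra_simps)
  have "poly_ev h s (p * q) = poly_ev h s p * poly_ev h s q" for p q
    by (induction p)
      (simp_all add: poly_ev_pCons poly_ev_0 h add smult ring_map_simps[OF h] algebra_simps)
  then show ?thesis
    using add poly_ev_const[OF h, of s 1] by (simp add: ring_map_def ring_map_1[OF h] one_pCons)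
qed

lemma poly_ev_eq_sum:
  assumes "ring_map h" "degree p \<le> n"
  shows "poly_ev h s p = (\<Sum>l\<le>n. h (coeff p l) * s ^ l)"
  using assms(2)
proof (induction p arbitrary: n)
  case 0
  then show ?case by (simp add: poly_ev_0 ring_map_0[OF assms(1)])
next
  case (pCons c p)
  show ?case
  proof (cases n)
    case 0
    then have "p = 0" using pCons.prems by (auto split: if_splits)
    then show ?thesis using 0 by (simp add: poly_ev_const assms(1))
  next
    case (Suc m)
    have "degree p \<le> m" using pCons.prems Suc by (auto split: if_splits)
    then have "poly_ev h s p = (\<Sum>l\<le>m. h (coeff p l) * s ^ l)" by (rule pCons.IH)
    then show ?thesis
      by (simp add: poly_ev_pCons assms(1) Suc sum.atMost_Suc_shift sum_distrib_left mult_ac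
        del: sum.atMost_Suc)
  qed
qed

lemma poly_ev_monom:
  assumes "ring_map h"
  shows "poly_ev h s (monom c n) = h c * s ^ n"
  by (induction n) (simp_all add: monom_0 monom_Suc poly_ev_const poly_ev_pCons assms
    poly_ev_0 ring_map_0[OF assms] mult_ac)

lemma ring_map_poly_ev_ring_map:
  assumes "ring_map g" "ring_map h"
  shows "g (poly_ev h s p) = poly_ev (\<lambda>c. g (h c)) (g s) p"
proof -
  have "ring_map (\<lambda>c. g (h c))"
    using assms by (simp add: ring_map_def)
  then show ?thesis
    by (induction p)
      (simp_all add: poly_ev_0 poly_ev_pCons assms ring_map_simps[OF assms(1)])
qed

section \<open>Leading terms of Laurent series\<close>

text \<open>A lower bound instead of the order itself: it is stable under sums and holds for 0 at
  every level, whereas \<open>fls_subdegree 0\<close> is the default value 0.\<close>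

definition order_ge :: "'c::zero fls \<Rightarrow> int \<Rightarrow> bool" where
  "order_ge f a \<longleftrightarrow> (\<forall>j<a. f $$ j = 0)"

abbreviation lowest_coeff :: "'c::zero fls \<Rightarrow> 'c" where
  "lowest_coeff f \<equiv> f $$ fls_subdegree f"

lemma order_ge_iff: "f \<noteq> 0 \<Longrightarrow> order_ge f a \<longleftrightarrow> a \<le> fls_subdegree f"
  unfolding order_ge_def
  by (metis fls_eq0_below_subdegree linorder_not_less nth_fls_subdegree_nonzero order_less_le_trans)

lemma order_ge_0 [simp]: "order_ge 0 a"
  by (simp add: order_ge_def)

lemma order_ge_add: "order_ge f a \<Longrightarrow> order_ge g a \<Longrightarrow> order_ge (f + g) a"
  for f g :: "'c::comm_ring_1 fls"
  by (simp add: order_ge_def)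

lemma order_ge_diff: "order_ge f a \<Longrightarrow> order_ge g a \<Longrightarrow> order_ge (f - g) a"
  for f g :: "'c::comm_ring_1 fls"
  by (simp add: order_ge_def)

lemma order_ge_uminus: "order_ge f a \<Longrightarrow> order_ge (- f) a"
  for f :: "'c::comm_ring_1 fls"
  by (simp add: order_ge_def)

lemma order_ge_sum: "(\<And>i. i \<in> A \<Longrightarrow> order_ge (f i) a) \<Longrightarrow> order_ge (sum f A) a"
  for f :: "'i \<Rightarrow> 'c::comm_ring_1 fls"
  by (induction A rule: infinite_finite_induct) (auto intro: order_ge_add)

lemma fls_nth_sum': "sum f A $$ a = (\<Sum>i\<in>A. f i $$ a)"
  for f :: "'i \<Rightarrow> 'c::comm_ring_1 fls"
  by (induction A rule: infinite_finite_induct) auto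

lemma order_ge_mult: "order_ge f a \<Longrightarrow> order_ge g b \<Longrightarrow> order_ge (f * g) (a + b)"
  for f g :: "'c::idom fls"
  by (cases "f = 0 \<or> g = 0") (auto simp: order_ge_iff)

text \<open>If one of the two bounds is not attained, both sides are 0; no knowledge of the exact
  orders is required.\<close>

lemma nth_mult_order_ge:
  fixes f g :: "'c::idom fls"
  assumes "order_ge f a" "order_ge g b"
  shows "(f * g) $$ (a + b) = f $$ a * g $$ b"
proof (cases "f = 0 \<or> g = 0")
  case False
  then have le: "a \<le> fls_subdegree f" "b \<le> fls_subdegree g"
    using assms by (auto simp: order_ge_iff)
  show ?thesis
  proof (cases "a = fls_subdegree f \<and> b = fls_subdegree g")
    case True
    then show ?thesis using fls_times_base[of f g] by simp
  next
    case F: False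
    then have "a + b < fls_subdegree f + fls_subdegree g" using le by linarith
    then have "(f * g) $$ (a + b) = 0" by (rule fls_times_nth_eq0)
    moreover have "f $$ a = 0 \<or> g $$ b = 0"
      using F le by (metis fls_eq0_below_subdegree order_le_less)
    ultimately show ?thesis by auto
  qed
qed auto

lemma order_ge_power: "order_ge f a \<Longrightarrow> order_ge (f ^ n) (int n * a)"
  for f :: "'c::idom fls"
proof (induction n)
  case (Suc n)
  then show ?case using order_ge_mult[of f a "f ^ n" "int n * a"] by (simp add: algebra_simps)
qed (simp add: order_ge_def)

lemma nth_power_order_ge: "order_ge f a \<Longrightarrow> (f ^ n) $$ (int n * a) = (f $$ a) ^ n"
  for f :: "'c::idom fls"
proof (induction n)
  case (Suc n)
  then show ?case
    using nth_mult_order_ge[of f a "f ^ n" "int n * a"] order_ge_power[of f a n]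
    by (simp add: algebra_simps)
qed simp

lemma order_ge_X_intpow: "order_ge (fls_X_intpow a :: 'c::idom fls) a"
  by (simp add: order_ge_def)

lemma subdegree_eqI_order_ge: "order_ge f a \<Longrightarrow> f $$ a \<noteq> 0 \<Longrightarrow> fls_subdegree f = a"
  by (rule fls_subdegree_eqI) (auto simp: order_ge_def)

lemma order_ge_Suc: "order_ge f a \<Longrightarrow> f $$ a = 0 \<Longrightarrow> order_ge f (a + 1)"
  unfolding order_ge_def by (metis zle_add1_eq_le order_le_less)

lemma order_ge_mono: "order_ge f a \<Longrightarrow> b \<le> a \<Longrightarrow> order_ge f b"
  unfolding order_ge_def by auto

text \<open>The condition \<open>R\<close> is the same for all terms, so the least exponent
  satisfying it is at most the exponent of each nonzero term and works for all of them at
  once.\<close>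

lemma power_dvd_sum_Least:
  fixes t :: "'i \<Rightarrow> 'c::comm_semiring_1"
  assumes "\<And>i. i \<in> A \<Longrightarrow> t i \<noteq> 0 \<Longrightarrow> \<exists>k. R k \<and> \<pi> ^ k dvd t i" and "sum t A \<noteq> 0"
  shows "\<exists>k::nat. R k \<and> \<pi> ^ k dvd sum t A"
proof -
  obtain i where "i \<in> A" "t i \<noteq> 0" using assms(2) by (meson sum.not_neutral_contains_not_neutral)
  then have ex: "\<exists>k. R k" using assms(1) by blast
  have "\<pi> ^ (LEAST k. R k) dvd t i" if i: "i \<in> A" for i
  proof (cases "t i = 0")
    case False
    then obtain k where "R k" "\<pi> ^ k dvd t i" using assms(1) i by blast
    then show ?thesis by (meson Least_le dvd_trans le_imp_power_dvd)
  qed simp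
  then show ?thesis using ex by (meson LeastI_ex dvd_sum)
qed

section \<open>Leading terms after adjoining a fraction\<close>

text \<open>The fraction \<open>s\<close> has order \<open>fls_subdegree u - e\<close> and the
  lowest coefficient of \<open>u\<close>, so multiplication by \<open>s ^ l\<close> shifts the bound
  and scales the bottom coefficient.\<close>

lemma adjoin_term_order:
  fixes g u :: "'c::idom fls"
  assumes u: "u \<noteq> 0" and g: "order_ge g (w - int l * (fls_subdegree u - e))"
  defines "s \<equiv> u * fls_X_intpow (- e)"
  shows "order_ge (g * s ^ l) w"
    and "(g * s ^ l) $$ w = g $$ (w - int l * (fls_subdegree u - e)) * lowest_coeff u ^ l"
proof -
  have ou: "order_ge u (fls_subdegree u)" using order_ge_iff[OF u] by blast
  have s: "order_ge s (fls_subdegree u - e)"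
    using order_ge_mult[OF ou order_ge_X_intpow[of "- e"]] by (simp add: s_def)
  have "s $$ (fls_subdegree u - e) = lowest_coeff u"
    using nth_mult_order_ge[OF ou order_ge_X_intpow[of "- e"]] by (simp add: s_def)
  then show "(g * s ^ l) $$ w = g $$ (w - int l * (fls_subdegree u - e)) * lowest_coeff u ^ l"
    using nth_mult_order_ge[OF g order_ge_power[OF s, of l]] nth_power_order_ge[OF s, of l] by simp
  show "order_ge (g * s ^ l) w"
    using order_ge_mult[OF g order_ge_power[OF s, of l]] by simp
qed

text \<open>\<open>regular\<close> is a regular sequence condition on lowest terms: if
  \<open>X ^ e\<close> divides the lowest term of \<open>r\<close> times a positive power of that of
  \<open>u\<close>, the quotient being again a lowest term of the base ring, then
  \<open>X ^ e\<close> already divides the lowest term of \<open>r\<close> in this sense.\<close>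

locale adjoin_fraction =
  fixes h :: "'r::comm_ring_1 \<Rightarrow> 'c::idom fls" and x u :: 'r and e :: nat
  assumes h: "ring_map h" and hx: "h x = fls_X" and hu: "h u \<noteq> 0"
    and regular: "\<And>r s m. h r \<noteq> 0 \<Longrightarrow> h s \<noteq> 0 \<Longrightarrow>
      fls_subdegree (h s) = fls_subdegree (h r) + int (Suc m) * fls_subdegree (h u) - int e \<Longrightarrow>
      lowest_coeff (h s) = lowest_coeff (h r) * lowest_coeff (h u) ^ Suc m \<Longrightarrow>
      \<exists>r'. h r' \<noteq> 0 \<and> fls_subdegree (h r') = fls_subdegree (h r) - int e \<and>
        lowest_coeff (h r') = lowest_coeff (h r)"
begin

definition ev :: "'r poly \<Rightarrow> 'c fls" where
  "ev = poly_ev h (h u * fls_X_intpow (- int e))"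

definition \<delta> :: int where "\<delta> = fls_subdegree (h u) - int e"

text \<open>A bound on the presentation \<open>p\<close>, not on \<open>ev p\<close>: the new
  variable gets the weight \<open>\<delta>\<close>, the order of the adjoined fraction. Cancellation
  can make the order of \<open>ev p\<close> larger.\<close>

definition bounded :: "'r poly \<Rightarrow> int \<Rightarrow> bool" where
  "bounded p w \<longleftrightarrow> (\<forall>l. order_ge (h (Polynomial.coeff p l)) (w - int l * \<delta>))"

lemma ring_map_ev: "ring_map ev"
  unfolding ev_def by (rule ring_map_poly_ev[OF h])

lemma ev_sum: "degree p \<le> n \<Longrightarrow>
    ev p = (\<Sum>l\<le>n. h (coeff p l) * (h u * fls_X_intpow (- int e)) ^ l)"
  unfolding ev_def by (rule poly_ev_eq_sum[OF h])

lemma bounded_ev: "bounded p w \<Longrightarrow> order_ge (ev p) w"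
  unfolding ev_sum[OF order_refl]
  by (intro order_ge_sum adjoin_term_order(1)[OF hu]) (simp add: bounded_def \<delta>_def)

lemma bounded_nth: "bounded p w \<Longrightarrow> degree p \<le> n \<Longrightarrow>
    ev p $$ w = (\<Sum>l\<le>n. h (coeff p l) $$ (w - int l * \<delta>) * lowest_coeff (h u) ^ l)"
  unfolding ev_sum fls_nth_sum'
  unfolding \<delta>_def by (intro sum.cong refl adjoin_term_order(2)[OF hu]) (simp add: bounded_def \<delta>_def)

lemma bounded_exists: "\<exists>w. bounded p w"
proof -
  \<comment> \<open>A vanishing coefficient enters the minimum with the default order 0, which can
    only lower the bound.\<close>
  define w where "w = Min ((\<lambda>l. fls_subdegree (h (coeff p l)) + int l * \<delta>) ` {..degree p})"
  have "order_ge (h (coeff p l)) (w - int l * \<delta>)" for l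
  proof (cases "l \<le> degree p \<and> h (coeff p l) \<noteq> 0")
    case True
    then have "w \<le> fls_subdegree (h (coeff p l)) + int l * \<delta>"
      unfolding w_def by (intro Min_le) auto
    then show ?thesis using True by (simp add: order_ge_iff)
  next
    case False
    then have "h (coeff p l) = 0" by (auto simp: coeff_eq_0 ring_map_0[OF h])
    then show ?thesis by simp
  qed
  then show ?thesis by (auto simp: bounded_def)
qed

text \<open>
  If the terms of lowest possible order cancel, regularity shows that the coefficient of the highest
  power involved is, up to higher order, divisible by \<open>x ^ e\<close>, and that power can be lowered.
\<close>
lemma bounded_improve:
  assumes "bounded p w" "ev p $$ w = 0"
    "\<forall>l\<ge>m. h (coeff p l) $$ (w - int l * \<delta>) = 0"
  shows "\<exists>p'. ev p' = ev p \<and> bounded p' (w + 1)"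
  using assms
proof (induction m arbitrary: p)
  case 0
  have "order_ge (h (coeff p l)) (w + 1 - int l * \<delta>)" for l
    using order_ge_Suc[of "h (coeff p l)" "w - int l * \<delta>"] 0 by (simp add: bounded_def algebra_simps)
  then show ?case by (auto simp: bounded_def)
next
  case (Suc m)
  define r where "r = coeff p m"
  define W where "W l = w - int l * \<delta>" for l
  define c where "c = lowest_coeff (h u)"
  have ord: "order_ge (h (coeff p l)) (W l)" for l using Suc.prems(1) by (simp add: bounded_def W_def)
  show ?case
  proof (cases "h r $$ W m = 0")
    case True
    then have "\<forall>l\<ge>m. h (coeff p l) $$ (w - int l * \<delta>) = 0"
      using Suc.prems(3) by (metis W_def r_def le_antisym not_less_eq_eq)
    then show ?thesis using Suc by blast
  next
    case False
    then have r: "h r \<noteq> 0" "fls_subdegree (h r) = W m"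
      using ord[of m] by (auto simp: r_def intro: subdegree_eqI_order_ge)
    define n where "n = max (degree p) m"
    have "0 = (\<Sum>l\<le>n. h (coeff p l) $$ W l * c ^ l)"
      using bounded_nth[OF Suc.prems(1), of n] Suc.prems(2) by (simp add: W_def c_def n_def)
    also have "\<dots> = (\<Sum>l\<le>m. h (coeff p l) $$ W l * c ^ l)"
      by (rule sum.mono_neutral_right) (use Suc.prems(3) in \<open>auto simp: n_def W_def\<close>)
    also have "\<dots> = (\<Sum>l<m. h (coeff p l) $$ W l * c ^ l) + h r $$ W m * c ^ m"
      by (simp add: r_def flip: lessThan_Suc_atMost)
    finally have top: "h r $$ W m * c ^ m = - (\<Sum>l<m. h (coeff p l) $$ W l * c ^ l)"
      by (simp add: eq_neg_iff_add_eq_0 add.commute)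
    have c0: "c \<noteq> 0" using hu by (simp add: c_def)
    \<comment> \<open>For \<open>m = 0\<close> the sum in \<open>top\<close> is empty and the bottom
      coefficient of \<open>r\<close> would vanish.\<close>
    obtain k where k: "m = Suc k"
      using top False by (cases m) auto
    \<comment> \<open>Multiplying the cancellation relation by \<open>x ^ (e * k)\<close> clears the
      denominators of all lower terms and leaves a single \<open>x ^ e\<close> under the top one. So
      \<open>s\<close> has the lowest term of \<open>r * u ^ m / x ^ e\<close>, as regularity
      requires.\<close>
    define s where "s = - (\<Sum>l<m. coeff p l * u ^ l * x ^ (e * (k - l)))"
    define v where "v = w + int e * int k"
    have ou: "order_ge (h u) (fls_subdegree (h u))" using order_ge_iff[OF hu] by blast
    have summand: "order_ge (h (coeff p l * u ^ l * x ^ (e * (k - l)))) v \<and>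
        h (coeff p l * u ^ l * x ^ (e * (k - l))) $$ v = h (coeff p l) $$ W l * c ^ l"
      if "l < m" for l
    proof -
      have eq: "W l + int l * fls_subdegree (h u) + int (e * (k - l)) = v"
        using that k by (simp add: v_def W_def \<delta>_def algebra_simps of_nat_diff)
      have x: "h (x ^ (e * (k - l))) = fls_X_intpow (int (e * (k - l)))"
        by (simp add: ring_map_power[OF h] hx fls_X_power_conv_shift_1)
      have 1: "order_ge (h (coeff p l * u ^ l)) (W l + int l * fls_subdegree (h u))"
        using order_ge_mult[OF ord order_ge_power[OF ou]] by (simp add: ring_map_simps[OF h])
      have 2: "h (coeff p l * u ^ l) $$ (W l + int l * fls_subdegree (h u)) = h (coeff p l) $$ W l * c ^ l"
        using nth_mult_order_ge[OF ord order_ge_power[OF ou]] nth_power_order_ge[OF ou]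
        by (simp add: ring_map_simps[OF h] c_def)
      show ?thesis
        using order_ge_mult[OF 1 order_ge_X_intpow] nth_mult_order_ge[OF 1 order_ge_X_intpow]
        unfolding ring_map_mult[OF h, of "coeff p l * u ^ l"] x eq[symmetric] by (simp add: 2)
    qed
    have os: "order_ge (h s) v"
      unfolding s_def ring_map_minus[OF h] ring_map_sum[OF h]
      by (intro order_ge_uminus order_ge_sum) (use summand in auto)
    have sv: "h s $$ v = h r $$ W m * c ^ m"
      unfolding s_def ring_map_minus[OF h] ring_map_sum[OF h] top
      by (simp add: fls_nth_sum' summand)
    then have s: "h s \<noteq> 0" "fls_subdegree (h s) = v"
      using False c0 os by (auto intro: subdegree_eqI_order_ge)
    have "v = W m + int (Suc k) * fls_subdegree (h u) - int e"
      by (simp add: v_def W_def \<delta>_def k algebra_simps)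
    then obtain r' where r': "h r' \<noteq> 0" "fls_subdegree (h r') = W m - int e"
        "lowest_coeff (h r') = h r $$ W m"
      using regular[OF r(1) s(1), of k] s(2) r(2) sv by (auto simp: k c_def)
    \<comment> \<open>The value is unchanged because \<open>x ^ e\<close> times the adjoined
      fraction is \<open>u\<close>. The part \<open>x ^ e * r'\<close>, which carries the bottom
      coefficient of \<open>r\<close>, moves from degree \<open>m\<close> to degree
      \<open>k\<close>.\<close>
    define p' where "p' = p - monom (x ^ e * r') m + monom (r' * u) k"
    have xe: "h (x ^ e) = fls_X_intpow (int e)"
      by (simp add: ring_map_power[OF h] hx fls_X_power_conv_shift_1)
    have canc: "h (x ^ e) * fls_X_intpow (- int e) = 1"
      unfolding xe fls_X_intpow_times_fls_X_intpow by simp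
    have "ev p' = ev p - h r' * (h u * fls_X_intpow (- int e)) ^ k * h u * (h (x ^ e) * fls_X_intpow (- int e) - 1)"
      unfolding p'_def ring_map_simps[OF ring_map_ev] unfolding ev_def poly_ev_monom[OF h] k
      by (simp add: ring_map_mult[OF h] algebra_simps)
    then have evp': "ev p' = ev p" unfolding canc by simp
    have or': "order_ge (h r') (W m - int e)" using order_ge_iff[OF r'(1)] r'(2) by simp
    have nr': "h r' $$ (W m - int e) = h r $$ W m" using r'(2,3) by simp
    have o1: "order_ge (h (x ^ e * r')) (W m)" "h (x ^ e * r') $$ W m = h r $$ W m"
      using order_ge_mult[OF order_ge_X_intpow or', of "int e"]
        nth_mult_order_ge[OF order_ge_X_intpow or', of "int e"]
      by (simp_all add: ring_map_mult[OF h] xe nr')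
    have Wk: "W k = W m - int e + fls_subdegree (h u)"
      by (simp add: W_def k \<delta>_def algebra_simps)
    have o2: "order_ge (h (r' * u)) (W k)"
      using order_ge_mult[OF or' ou] by (simp add: ring_map_mult[OF h] Wk)
    have "order_ge (h (coeff p' l)) (W l)" for l
      using ord[of l] o1(1) o2 unfolding p'_def coeff_add coeff_diff coeff_monom
      by (auto simp: ring_map_simps[OF h] intro!: order_ge_add order_ge_diff)
    then have bp': "bounded p' w" by (simp add: bounded_def W_def)
    have "h (coeff p' l) $$ W l = 0" if "l \<ge> m" for l
    proof (cases "l = m")
      case True
      then show ?thesis
        using o1(2) k by (simp add: p'_def ring_map_simps[OF h] r_def)
    next
      case False
      then show ?thesis using that k Suc.prems(3) by (auto simp: p'_def W_def)
    qed
    then show ?thesis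
      using Suc.IH[OF bp'] evp' Suc.prems(2) by (simp add: W_def)
  qed
qed

text \<open>Each improvement closes the gap between the bound and the fixed order of
  \<open>ev p\<close> by one.\<close>

lemma bounded_exact:
  assumes "bounded p w" "ev p \<noteq> 0"
  shows "\<exists>p'. ev p' = ev p \<and> bounded p' (fls_subdegree (ev p))"
  using assms
proof (induction "nat (fls_subdegree (ev p) - w)" arbitrary: p w rule: less_induct)
  case less
  have le: "w \<le> fls_subdegree (ev p)" using bounded_ev less.prems order_ge_iff by blast
  show ?case
  proof (cases "w = fls_subdegree (ev p)")
    case False
    then have "ev p $$ w = 0" using le by simp
    moreover have "\<forall>l\<ge>Suc (degree p). h (coeff p l) $$ (w - int l * \<delta>) = 0"
      by (auto simp: coeff_eq_0 ring_map_0[OF h])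
    ultimately obtain p' where "ev p' = ev p" "bounded p' (w + 1)"
      using bounded_improve[OF less.prems(1)] by blast
    then show ?thesis using less.hyps[of p' "w + 1"] less.prems le False by auto
  qed (use less.prems in blast)
qed

text \<open>Read off from a presentation with exact bound: each nonzero bottom coefficient there is
  the lowest coefficient of an element of the base ring, whose order is forced by the
  weight.\<close>

lemma leading_term_expansion:
  assumes "ev p \<noteq> 0"
  shows "\<exists>n c. lowest_coeff (ev p) = (\<Sum>l\<le>n. c l * lowest_coeff (h u) ^ l) \<and>
    (\<forall>l. c l \<noteq> 0 \<longrightarrow> (\<exists>r. h r \<noteq> 0 \<and>
      fls_subdegree (h r) = fls_subdegree (ev p) - int l * (fls_subdegree (h u) - int e) \<and>
      lowest_coeff (h r) = c l))"
proof -
  obtain p' where p': "ev p' = ev p" "bounded p' (fls_subdegree (ev p))"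
    using bounded_exists bounded_exact assms by metis
  define c where "c l = h (coeff p' l) $$ (fls_subdegree (ev p) - int l * \<delta>)" for l
  have "fls_subdegree (h (coeff p' l)) = fls_subdegree (ev p) - int l * \<delta>" if "c l \<noteq> 0" for l
    using p'(2) that by (intro subdegree_eqI_order_ge) (auto simp: bounded_def c_def)
  then have "\<exists>r. h r \<noteq> 0 \<and>
      fls_subdegree (h r) = fls_subdegree (ev p) - int l * (fls_subdegree (h u) - int e) \<and>
      lowest_coeff (h r) = c l" if "c l \<noteq> 0" for l
    using that by (intro exI[of _ "coeff p' l"]) (auto simp: c_def \<delta>_def)
  moreover have "lowest_coeff (ev p) = (\<Sum>l\<le>degree p'. c l * lowest_coeff (h u) ^ l)"
    using bounded_nth[OF p'(2) order_refl] by (simp add: p'(1) c_def)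
  ultimately show ?thesis by blast
qed

end

section \<open>The rings inside Laurent series\<close>

text \<open>\<open>k[X, Z]\<close> is embedded in \<open>k[Z]((X))\<close>, where the coefficient of \<open>X ^ n\<close> is a polynomial in \<open>Z\<close>.\<close>

definition laurent_X :: "'k::field poly \<Rightarrow> 'k poly fls" where
  "laurent_X = poly_ev (\<lambda>c. fls_const [:c:]) fls_X"

definition laurent :: "'k::field poly poly \<Rightarrow> 'k poly fls" where
  "laurent = poly_ev laurent_X (fls_const [:0, 1:])"

definition poly_in_Z :: "'k::field poly \<Rightarrow> 'k poly poly" where
  "poly_in_Z = map_poly (\<lambda>c. [:c:])"

lemma ring_map_const: "ring_map (\<lambda>c::'k::field. fls_const [:c:])"
  by (simp add: ring_map_def one_pCons[symmetric] fls_plus_const mult.commute)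

lemma ring_map_laurent_X: "ring_map laurent_X"
  unfolding laurent_X_def by (rule ring_map_poly_ev[OF ring_map_const])

lemma ring_map_laurent: "ring_map laurent"
  unfolding laurent_def by (rule ring_map_poly_ev[OF ring_map_laurent_X])

lemmas laurent_simps = ring_map_simps[OF ring_map_laurent]

lemma laurent_X_pCons: "laurent_X (pCons c p) = fls_const [:c:] + fls_X * laurent_X p"
  by (simp add: laurent_X_def poly_ev_pCons ring_map_const)

lemma laurent_pCons: "laurent (pCons c p) = laurent_X c + fls_const [:0, 1:] * laurent p"
  by (simp add: laurent_def poly_ev_pCons ring_map_laurent_X)

lemma laurent_X_const: "laurent_X [:c:] = fls_const [:c:]"
  by (simp add: laurent_X_pCons ring_map_simps[OF ring_map_laurent_X])

lemma laurent_X_nth: "laurent_X p $$ j = (if j < 0 then 0 else [:coeff p (nat j):])"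
proof (induction p arbitrary: j)
  case 0
  then show ?case by (simp add: laurent_X_def poly_ev_0)
next
  case (pCons c p)
  show ?case
  proof (cases "j \<le> 0")
    case True
    then show ?thesis by (auto simp: laurent_X_pCons pCons.IH fls_X_times_conv_shift)
  next
    case False
    then have "nat j = Suc (nat (j - 1))" by linarith
    then show ?thesis using False
      by (simp add: laurent_X_pCons pCons.IH fls_X_times_conv_shift)
  qed
qed

lemma coeff_laurent_nth:
  "coeff (laurent G $$ j) l = (if j < 0 then 0 else coeff (coeff G l) (nat j))"
proof (induction G arbitrary: l)
  case 0
  then show ?case by (simp add: laurent_simps)
next
  case (pCons c G)
  then show ?case
    by (cases l) (auto simp: laurent_pCons laurent_X_nth coeff_pCons)
qed

lemma order_ge_laurent: "order_ge (laurent G) 0"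
  by (simp add: order_ge_def poly_eq_iff coeff_laurent_nth)

lemma laurent_nth_0: "laurent G $$ 0 = at_X_0 G"
  by (simp add: poly_eq_iff coeff_laurent_nth at_X_0_def coeff_map_poly poly_0_coeff_0)

lemma laurent_eq_0_iff [simp]: "laurent G = 0 \<longleftrightarrow> G = 0"
proof
  assume "laurent G = 0"
  then have "coeff (coeff G l) n = 0" for l n
    using coeff_laurent_nth[of G "int n" l] by simp
  then show "G = 0" by (simp add: poly_eq_iff)
qed (simp add: laurent_simps)

lemma laurent_var_X: "laurent (var_X ^ n :: 'k::field poly poly) = fls_X_intpow (int n)"
proof -
  have "laurent (var_X :: 'k poly poly) = fls_X"
    by (simp add: laurent_pCons laurent_X_pCons[of 0] laurent_X_const laurent_simps
      ring_map_1[OF ring_map_laurent_X] one_pCons[symmetric])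
  then show ?thesis
    by (simp only: ring_map_power[OF ring_map_laurent] fls_X_power_conv_shift_1)
qed

lemma laurent_const: "laurent [:[:c:]:] = fls_const [:c:]"
  by (simp add: laurent_pCons laurent_X_const laurent_simps)

lemma laurent_poly_in_Z: "laurent (poly_in_Z c) = fls_const c"
proof (intro fls_eqI poly_eqI)
  fix j l
  show "coeff (laurent (poly_in_Z c) $$ j) l = coeff (fls_const c $$ j) l"
    by (simp add: coeff_laurent_nth poly_in_Z_def coeff_map_poly coeff_pCons split: nat.split)
qed

lemma var_X_power: "var_X ^ n = [:monom 1 n :: 'k::field poly:]"
  by (simp add: poly_const_pow monom_altdef)

lemma order_ge_laurent_dvd:
  assumes "order_ge (laurent G) (int n)"
  shows "var_X ^ n dvd G"
proof
  have "coeff (coeff G l) i = 0" if "i < n" for l i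
    using assms that coeff_laurent_nth[of G "int i" l] by (simp add: order_ge_def)
  then show "G = var_X ^ n * map_poly (poly_shift n) G"
    unfolding var_X_power
    by (auto simp: poly_eq_iff coeff_map_poly coeff_monom_mult coeff_poly_shift)
qed

lemma lowest_coeff_exists:
  assumes "i \<ge> 0" "c \<noteq> 0"
  shows "order_ge (laurent (var_X ^ nat i * poly_in_Z c)) i"
    "laurent (var_X ^ nat i * poly_in_Z c) $$ i = c"
proof -
  have "order_ge (fls_const c) 0" by (simp add: order_ge_def)
  then show "order_ge (laurent (var_X ^ nat i * poly_in_Z c)) i"
    "laurent (var_X ^ nat i * poly_in_Z c) $$ i = c"
    using order_ge_mult[OF order_ge_X_intpow[of i], of "fls_const c" 0]
      nth_mult_order_ge[OF order_ge_X_intpow[of i], of "fls_const c" 0] assms(1)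
    by (simp_all add: ring_map_mult[OF ring_map_laurent] laurent_var_X laurent_poly_in_Z)
qed

section \<open>Lowest terms in the double Danielewski ring\<close>

locale double_danielewski =
  fixes P :: "'k::field poly poly" and Q :: "'k poly poly poly" and d e :: nat
  assumes d: "d > 0" and e: "e > 0"
    and P: "lead_coeff P = 1" "degree P \<ge> 2"
    and Q: "lead_coeff Q = 1" "degree Q \<ge> 2"
begin

definition "P0 = at_X_0 P"

lemma P0: "degree P0 = degree P" "lead_coeff P0 = 1"
proof -
  have "coeff P0 (degree P) = 1"
    using P by (simp add: P0_def at_X_0_def coeff_map_poly)
  moreover have "degree P0 \<le> degree P"
    unfolding P0_def at_X_0_def by (rule map_poly_degree_leq)
  ultimately show "degree P0 = degree P" "lead_coeff P0 = 1"
    by (metis le_antisym le_degree zero_neq_one)+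
qed

lemma P0_nz: "P0 \<noteq> 0"
  using P0(2) by auto

lemma laurent_P: "laurent P \<noteq> 0" "fls_subdegree (laurent P) = 0" "laurent P $$ 0 = P0"
proof -
  show "laurent P \<noteq> 0" using P by auto
  show "fls_subdegree (laurent P) = 0"
    using P0_nz by (intro subdegree_eqI_order_ge order_ge_laurent) (simp add: laurent_nth_0 P0_def)
  show "laurent P $$ 0 = P0" by (simp add: laurent_nth_0 P0_def)
qed

text \<open>As \<open>P\<close> has order 0, the premises of regularity force \<open>r\<close> to
  have order at least \<open>d\<close>; and every \<open>c * X ^ i\<close> with
  \<open>i \<ge> 0\<close> is itself in \<open>k[X, Z]\<close>. Regularity is thus a matter of
  orders alone.\<close>

sublocale Y: adjoin_fraction laurent var_X P d
proof
  show "ring_map laurent" by (rule ring_map_laurent)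
  show "laurent var_X = fls_X" using laurent_var_X[of 1] by (simp add: fls_X_conv_shift_1)
  show "laurent P \<noteq> 0" by (rule laurent_P)
  fix r s :: "'k poly poly" and m
  assume r: "laurent r \<noteq> 0" and s: "laurent s \<noteq> 0"
    and eq: "fls_subdegree (laurent s) =
      fls_subdegree (laurent r) + int (Suc m) * fls_subdegree (laurent P) - int d"
  let ?i = "fls_subdegree (laurent r) - int d"
  have i: "?i \<ge> 0" using eq order_ge_laurent[of s] s by (simp add: laurent_P order_ge_iff)
  have c: "lowest_coeff (laurent r) \<noteq> 0" using r by simp
  show "\<exists>r'. laurent r' \<noteq> 0 \<and> fls_subdegree (laurent r') = ?i \<and>
      lowest_coeff (laurent r') = lowest_coeff (laurent r)"
    using lowest_coeff_exists[OF i c] c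
    by (intro exI[of _ "var_X ^ nat ?i * poly_in_Z (lowest_coeff (laurent r))"])
      (auto simp: subdegree_eqI_order_ge simp del: laurent_eq_0_iff)
qed

abbreviation "ev_Y \<equiv> Y.ev"

lemma ev_Y_const: "ev_Y [:c:] = laurent c"
  unfolding Y.ev_def by (rule poly_ev_const[OF ring_map_laurent])

text \<open>A factor \<open>y\<close> brings a pole of order \<open>d\<close> and a factor
  \<open>P0\<close>. Each nonzero summand of the expansion has enough of them to account for the
  order, and the least sufficient exponent is common to all summands.\<close>

lemma ev_Y_leading:
  assumes "ev_Y p \<noteq> 0"
  shows "\<exists>k. fls_subdegree (ev_Y p) + int k * int d \<ge> 0 \<and> P0 ^ k dvd lowest_coeff (ev_Y p)"
proof -
  obtain n c where c: "lowest_coeff (ev_Y p) = (\<Sum>l\<le>n. c l * P0 ^ l)"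
    "\<forall>l. c l \<noteq> 0 \<longrightarrow> (\<exists>r. laurent r \<noteq> 0 \<and>
      fls_subdegree (laurent r) = fls_subdegree (ev_Y p) - int l * (0 - int d) \<and>
      lowest_coeff (laurent r) = c l)"
    using Y.leading_term_expansion[OF assms, unfolded laurent_P] by blast
  have "fls_subdegree (ev_Y p) + int l * int d \<ge> 0" if nz: "c l \<noteq> 0" for l
  proof -
    obtain r :: "'k poly poly" where "laurent r \<noteq> 0"
      "fls_subdegree (laurent r) = fls_subdegree (ev_Y p) + int l * int d"
      using c(2)[rule_format, OF nz] by auto
    then show ?thesis using order_ge_laurent[of r] by (metis order_ge_iff)
  qed
  then have "\<exists>k. fls_subdegree (ev_Y p) + int k * int d \<ge> 0 \<and> P0 ^ k dvd (\<Sum>l\<le>n. c l * P0 ^ l)"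
    using assms by (intro power_dvd_sum_Least) (auto simp flip: c(1) intro: dvd_triv_right)
  then show ?thesis by (simp add: c(1))
qed

text \<open>Converse to \<open>ev_Y_leading\<close>, realized by the monomial
  \<open>X ^ (i + k * d) * c * y ^ k\<close>.\<close>

lemma ev_Y_leading_exists:
  assumes "i + int k * int d \<ge> 0" "c \<noteq> 0"
  shows "\<exists>r. ev_Y r \<noteq> 0 \<and> fls_subdegree (ev_Y r) = i \<and> lowest_coeff (ev_Y r) = c * P0 ^ k"
proof -
  define g where "g = var_X ^ nat (i + int k * int d) * poly_in_Z c"
  have "ev_Y (monom g k) = laurent g * (laurent P * fls_X_intpow (- int d)) ^ k"
    unfolding Y.ev_def by (rule poly_ev_monom[OF ring_map_laurent])
  then have "order_ge (ev_Y (monom g k)) i" and nth: "ev_Y (monom g k) $$ i = c * P0 ^ k"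
    using adjoin_term_order[OF laurent_P(1), of "laurent g" i k d] lowest_coeff_exists[OF assms]
    by (simp_all add: laurent_P g_def)
  moreover have "c * P0 ^ k \<noteq> 0" using assms(2) P0_nz by simp
  ultimately show ?thesis
    by (intro exI[of _ "monom g k"]) (auto simp: subdegree_eqI_order_ge)
qed

text \<open>Since \<open>y\<close> has a pole of order \<open>d > 0\<close> and the coefficients of
  \<open>Q\<close> have none, only the top power reaches the lowest order, and its coefficient is
  1.\<close>

lemma ev_Y_Q:
  "ev_Y Q \<noteq> 0" "fls_subdegree (ev_Y Q) = - int d * int (degree Q)"
  "ev_Y Q $$ (- (int d * int (degree Q))) = P0 ^ degree Q"
proof -
  let ?y = "laurent P * fls_X_intpow (- int d)" and ?w = "- int d * int (degree Q)"
  let ?t = "\<lambda>l. laurent (coeff Q l) * ?y ^ l"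
  have eq: "ev_Y Q = (\<Sum>l\<le>degree Q. ?t l)"
    by (rule Y.ev_sum) simp
  have ord: "order_ge (laurent (coeff Q l)) (?w - int l * (fls_subdegree (laurent P) - int d))"
    if l: "l \<le> degree Q" for l
    using l by (intro order_ge_mono[OF order_ge_laurent]) (simp add: laurent_P flip: of_nat_mult)
  have nth: "?t l $$ ?w = (if l = degree Q then P0 ^ degree Q else 0)" if l: "l \<le> degree Q" for l
  proof (cases "l = degree Q")
    case True
    then show ?thesis
      using adjoin_term_order(2)[OF laurent_P(1) ord[OF l]] Q(1)
      by (simp add: laurent_P laurent_simps)
  next
    case False
    then have "?w - int l * (fls_subdegree (laurent P) - int d) < 0"
      using l d by (simp add: laurent_P flip: of_nat_mult)
    then show ?thesis
      using adjoin_term_order(2)[OF laurent_P(1) ord[OF l]] False order_ge_laurent[of "coeff Q l"]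
      by (simp add: order_ge_def laurent_P)
  qed
  have o: "order_ge (ev_Y Q) ?w"
    unfolding eq by (intro order_ge_sum adjoin_term_order(1)[OF laurent_P(1)] ord) auto
  have n: "ev_Y Q $$ ?w = P0 ^ degree Q"
  proof -
    have "ev_Y Q $$ ?w = (\<Sum>l\<le>degree Q. if l = degree Q then P0 ^ degree Q else 0)"
      unfolding eq fls_nth_sum' by (intro sum.cong refl nth) simp
    then show ?thesis by simp
  qed
  then show "ev_Y Q \<noteq> 0" "fls_subdegree (ev_Y Q) = ?w"
    "ev_Y Q $$ (- (int d * int (degree Q))) = P0 ^ degree Q"
    using o P0_nz by (auto simp: subdegree_eqI_order_ge)
qed

text \<open>Lowest terms of \<open>k[X, Z][y]\<close> are characterized by divisibility by powers of
  \<open>P0\<close>, and the lowest coefficient of \<open>Q\<close> is itself such a power;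
  regularity amounts to cancelling it.\<close>

sublocale T: adjoin_fraction ev_Y "[:var_X:]" Q e
proof
  show "ring_map ev_Y" by (rule Y.ring_map_ev)
  show "ev_Y [:var_X:] = fls_X" using laurent_var_X[of 1] by (simp add: fls_X_conv_shift_1 ev_Y_const)
  show "ev_Y Q \<noteq> 0" by (rule ev_Y_Q)
  fix r s :: "'k poly poly poly" and m
  assume r: "ev_Y r \<noteq> 0" and s: "ev_Y s \<noteq> 0"
    and eq: "fls_subdegree (ev_Y s) =
      fls_subdegree (ev_Y r) + int (Suc m) * fls_subdegree (ev_Y Q) - int e"
    and lc: "lowest_coeff (ev_Y s) = lowest_coeff (ev_Y r) * lowest_coeff (ev_Y Q) ^ Suc m"
  let ?i = "fls_subdegree (ev_Y r) - int e" and ?c = "lowest_coeff (ev_Y r)"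
  let ?M = "degree Q * Suc m"
  have c0: "?c \<noteq> 0" using r by simp
  have "lowest_coeff (ev_Y s) = ?c * P0 ^ ?M"
    using lc by (simp add: ev_Y_Q power_add power_mult)
  then obtain k where k: "fls_subdegree (ev_Y s) + int k * int d \<ge> 0" "P0 ^ k dvd ?c * P0 ^ ?M"
    using ev_Y_leading[OF s] by auto
  have k1: "?i + (int k - int ?M) * int d \<ge> 0"
    using k(1) eq by (simp add: ev_Y_Q algebra_simps)
  \<comment> \<open>Of the \<open>k\<close> factors \<open>P0\<close> in the lowest coefficient of
    \<open>s\<close>, up to \<open>?M\<close> may come from \<open>Q\<close>; only the surplus has
    to divide \<open>?c\<close>. For \<open>k \<le> ?M\<close> the order \<open>?i\<close> is
    already nonnegative and no factor is demanded.\<close>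
  have "\<exists>k' c'. ?i + int k' * int d \<ge> 0 \<and> ?c = c' * P0 ^ k'"
  proof (cases "k \<le> ?M")
    case True
    then have "int k \<le> int ?M" by (rule of_nat_mono)
    then have "(int k - int ?M) * int d \<le> 0"
      by (intro mult_nonpos_nonneg) (simp_all only: diff_le_0_iff_le of_nat_0_le_iff)
    then show ?thesis using k1 by (intro exI[of _ 0] exI[of _ ?c]) simp
  next
    case False
    then have "k = (k - ?M) + ?M" by simp
    then have "P0 ^ (k - ?M) * P0 ^ ?M dvd ?c * P0 ^ ?M" using k(2) by (metis power_add)
    then have "P0 ^ (k - ?M) dvd ?c" using P0_nz by simp
    then obtain c' where "?c = c' * P0 ^ (k - ?M)" by (metis dvdE mult.commute)
    moreover have "int (k - ?M) = int k - int ?M" using False by simp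
    ultimately show ?thesis using k1 by metis
  qed
  then obtain k' c' where k': "?i + int k' * int d \<ge> 0" "?c = c' * P0 ^ k'" by blast
  then show "\<exists>r'. ev_Y r' \<noteq> 0 \<and> fls_subdegree (ev_Y r') = ?i \<and> lowest_coeff (ev_Y r') = ?c"
    using ev_Y_leading_exists[OF k'(1), of c'] c0 by auto
qed

abbreviation "ev_B \<equiv> T.ev"

text \<open>A factor \<open>t\<close> brings a pole of order \<open>d * degree Q + e\<close> and
  \<open>P0 ^ degree Q\<close>, a factor \<open>y\<close> a pole of order \<open>d\<close> and
  \<open>P0\<close>. The least total exponent of \<open>P0\<close> that can account for the order
  divides all summands.\<close>

lemma ev_B_leading:
  assumes "ev_B p \<noteq> 0"
  shows "\<exists>l k. fls_subdegree (ev_B p) + int l * int (d * degree Q + e) + int k * int d \<ge> 0 \<and>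
    P0 ^ (degree Q * l + k) dvd lowest_coeff (ev_B p)"
proof -
  let ?R = "\<lambda>n. \<exists>l k. n = degree Q * l + k \<and>
    fls_subdegree (ev_B p) + int l * int (d * degree Q + e) + int k * int d \<ge> 0"
  obtain n c where c: "lowest_coeff (ev_B p) = (\<Sum>l\<le>n. c l * (P0 ^ degree Q) ^ l)"
    "\<And>l. c l \<noteq> 0 \<Longrightarrow> \<exists>r. ev_Y r \<noteq> 0 \<and>
      fls_subdegree (ev_Y r) = fls_subdegree (ev_B p) + int l * int (d * degree Q + e) \<and>
      lowest_coeff (ev_Y r) = c l"
    using T.leading_term_expansion[OF assms] by (fastforce simp: ev_Y_Q algebra_simps)
  have "\<exists>n. ?R n \<and> P0 ^ n dvd c l * (P0 ^ degree Q) ^ l" if nz: "c l \<noteq> 0" for l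
  proof -
    obtain r where r: "ev_Y r \<noteq> 0"
      "fls_subdegree (ev_Y r) = fls_subdegree (ev_B p) + int l * int (d * degree Q + e)"
      "lowest_coeff (ev_Y r) = c l"
      using c(2)[OF nz] by blast
    obtain k where k: "fls_subdegree (ev_Y r) + int k * int d \<ge> 0" "P0 ^ k dvd c l"
      using ev_Y_leading[OF r(1)] r(3) by auto
    then have "P0 ^ (degree Q * l + k) dvd c l * (P0 ^ degree Q) ^ l"
      using mult_dvd_mono[of "P0 ^ k" "c l" "(P0 ^ degree Q) ^ l" "(P0 ^ degree Q) ^ l"]
      by (simp add: power_add power_mult mult.commute[of "P0 ^ k"])
    then show ?thesis using k r(2) by auto
  qed
  then have "\<exists>m. ?R m \<and> P0 ^ m dvd (\<Sum>l\<le>n. c l * (P0 ^ degree Q) ^ l)"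
    using assms by (intro power_dvd_sum_Least) (auto simp flip: c(1))
  then show ?thesis by (auto simp: c(1))
qed

end

section \<open>Lowest terms as a rank two valuation\<close>

definition lead_deg :: "'c::idom poly fls \<Rightarrow> int" where
  "lead_deg f = int (degree (lowest_coeff f))"

context
  fixes f g :: "'c::idom poly fls"
  assumes nz: "f \<noteq> 0" "g \<noteq> 0"
begin

lemma lead_deg_mult: "lead_deg (f * g) = lead_deg f + lead_deg g"
  using nz by (simp add: lead_deg_def fls_times_base degree_mult_eq)

text \<open>Different pairs cannot cancel: the smaller order wins, and at equal orders the larger
  degree.\<close>

lemma lead_add:
  assumes "\<not> (fls_subdegree f = fls_subdegree g \<and> lead_deg f = lead_deg g)"
  shows "f + g \<noteq> 0 \<and>
    (fls_subdegree (f + g) = fls_subdegree f \<and> lead_deg (f + g) = lead_deg f \<or>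
     fls_subdegree (f + g) = fls_subdegree g \<and> lead_deg (f + g) = lead_deg g)"
proof -
  have o: "order_ge f (fls_subdegree f)" "order_ge g (fls_subdegree g)"
    using nz order_ge_iff by blast+
  have nz': "lowest_coeff f \<noteq> 0" "lowest_coeff g \<noteq> 0" using nz by auto
  consider "fls_subdegree f < fls_subdegree g" | "fls_subdegree g < fls_subdegree f"
    | "fls_subdegree f = fls_subdegree g" by linarith
  then show ?thesis
  proof cases
    case 1
    have "order_ge (f + g) (fls_subdegree f)"
      using o 1 by (intro order_ge_add order_ge_mono[OF o(2)]) auto
    moreover have eq: "(f + g) $$ fls_subdegree f = lowest_coeff f" using 1 by simp
    moreover have fg: "f + g \<noteq> 0" using eq nz' by (metis fls_zero_nth)
    ultimately have "fls_subdegree (f + g) = fls_subdegree f"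
      using nz' by (intro subdegree_eqI_order_ge) auto
    then show ?thesis using 1 eq fg by (auto simp: lead_deg_def)
  next
    case 2
    have "order_ge (f + g) (fls_subdegree g)"
      using o 2 by (intro order_ge_add order_ge_mono[OF o(1)]) auto
    moreover have eq: "(f + g) $$ fls_subdegree g = lowest_coeff g" using 2 by simp
    moreover have fg: "f + g \<noteq> 0" using eq nz' by (metis fls_zero_nth)
    ultimately have "fls_subdegree (f + g) = fls_subdegree g"
      using nz' by (intro subdegree_eqI_order_ge) auto
    then show ?thesis using 2 eq fg by (auto simp: lead_deg_def)
  next
    case 3
    define n where "n = fls_subdegree f"
    have ord: "order_ge (f + g) n" unfolding n_def using o 3 by (simp add: order_ge_add)
    have ne: "degree (f $$ n) \<noteq> degree (g $$ n)" using assms 3 by (auto simp: lead_deg_def n_def)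
    then have "f $$ n + g $$ n \<noteq> 0"
      by (metis add_eq_0_iff degree_minus)
    then have eq: "(f + g) $$ n \<noteq> 0" by simp
    then have fg: "f + g \<noteq> 0" by (metis fls_zero_nth)
    have "fls_subdegree (f + g) = n"
      using eq ord by (intro subdegree_eqI_order_ge) auto
    moreover have "degree (f $$ n + g $$ n) = degree (f $$ n) \<or> degree (f $$ n + g $$ n) = degree (g $$ n)"
      using ne by (metis degree_add_eq_left degree_add_eq_right nat_neq_iff)
    ultimately show ?thesis
      using 3 fg by (auto simp: lead_deg_def n_def)
  qed
qed

end

lemma lead_deg_power: "f \<noteq> 0 \<Longrightarrow> lead_deg (f ^ n) = int n * lead_deg f"
  for f :: "'c::idom poly fls"
proof (induction n)
  case 0
  then show ?case by (simp add: lead_deg_def)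
next
  case (Suc n)
  then show ?case by (simp add: lead_deg_mult algebra_simps)
qed

lemma lead_const: "c \<noteq> 0 \<Longrightarrow> fls_subdegree (fls_const [:c:]) = 0 \<and> lead_deg (fls_const [:c::'c::idom:]) = 0"
  by (simp add: lead_deg_def)

section \<open>Leading pairs on a polynomial ring \<open>k[a, b]\<close> embedded in
  \<open>k[Z]((X))\<close>\<close>

locale two_generators =
  fixes E :: "'k::field poly poly \<Rightarrow> 'k poly fls"
  assumes E: "ring_map E" and E_inj: "\<And>G. E G = 0 \<Longrightarrow> G = 0"
    and E_const: "\<And>c. E [:[:c:]:] = fls_const [:c:]"
begin

lemmas E_simps = ring_map_simps[OF E]

text \<open>
  Division with remainder by an element \<open>g\<close> of minimal degree in the second generator among those
  with \<open>\<rho> \<noteq> 0\<close>; the summands of the \<open>g\<close>-adic expansion have pairwise different values of \<open>\<rho>\<close>.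
\<close>
lemma leading_terms_generated:
  fixes \<rho> :: "'k poly fls \<Rightarrow> int" and u v :: int
  assumes \<rho>_def: "\<And>f. \<rho> f = u * fls_subdegree f + v * lead_deg f"
    and const: "\<And>C. C \<noteq> 0 \<Longrightarrow> \<rho> (E [:C:]) = 0" and ex: "\<exists>G. G \<noteq> 0 \<and> \<rho> (E G) \<noteq> 0"
  shows "\<exists>g. g \<noteq> 0 \<and> \<rho> (E g) \<noteq> 0 \<and> (\<forall>G. G \<noteq> 0 \<longrightarrow> (\<exists>(i::nat) G1 G2. G1 \<noteq> 0 \<and> G2 \<noteq> 0 \<and>
    \<rho> (E G1) = 0 \<and> \<rho> (E G2) = 0 \<and>
    fls_subdegree (E G) + fls_subdegree (E G2) = fls_subdegree (E G1) + int i * fls_subdegree (E g) \<and>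
    lead_deg (E G) + lead_deg (E G2) = lead_deg (E G1) + int i * lead_deg (E g)))"
proof -
  have E0: "E G = 0 \<longleftrightarrow> G = 0" for G using E_inj ring_map_0[OF E] by auto
  have mult: "fls_subdegree (E (F * G)) = fls_subdegree (E F) + fls_subdegree (E G)"
    "lead_deg (E (F * G)) = lead_deg (E F) + lead_deg (E G)"
    if "F \<noteq> 0" "G \<noteq> 0" for F G
    using that by (simp_all add: ring_map_mult[OF E] lead_deg_mult E0)
  obtain g where g: "g \<noteq> 0" "\<rho> (E g) \<noteq> 0"
    and min: "\<And>G. G \<noteq> 0 \<Longrightarrow> degree G < degree g \<Longrightarrow> \<rho> (E G) = 0"
    using ex ex_has_least_nat[of "\<lambda>G. G \<noteq> 0 \<and> \<rho> (E G) \<noteq> 0" _ degree]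
    by (metis (no_types, lifting) not_le)
  have deg: "degree g > 0"
    using const g by (metis degree_eq_zeroE gr0I pCons_eq_0_iff)
  have "\<exists>(i::nat) G1 G2. G1 \<noteq> 0 \<and> G2 \<noteq> 0 \<and> \<rho> (E G1) = 0 \<and> \<rho> (E G2) = 0 \<and>
    fls_subdegree (E G) + fls_subdegree (E G2) = fls_subdegree (E G1) + int i * fls_subdegree (E g) \<and>
    lead_deg (E G) + lead_deg (E G2) = lead_deg (E G1) + int i * lead_deg (E g)" if "G \<noteq> 0" for G
    using that
  proof (induction "degree G" arbitrary: G rule: less_induct)
    case less
    have one: "\<rho> (E 1) = 0" using const[of 1] by (simp add: one_pCons)
    show ?case
    proof (cases "degree G < degree g")
      case True
      then show ?thesis
        using min[OF less.prems True] less.prems one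
        by (intro exI[of _ 0] exI[of _ G] exI[of _ 1]) (simp add: ring_map_1[OF E] lead_deg_def)
    next
      case False
      \<comment> \<open>Pseudo-division, because the coefficients lie in \<open>k[X]\<close>. The
        extra factor \<open>C\<close> has \<open>\<rho>\<close>-value 0 and is absorbed into
        \<open>G2\<close>.\<close>
      obtain q r where qr: "pseudo_divmod G g = (q, r)" by force
      define C where "C = coeff g (degree g) ^ (Suc (degree G) - degree g)"
      have C: "C \<noteq> 0" using g by (simp add: C_def)
      have div: "smult C G = g * q + r" "r = 0 \<or> degree r < degree g"
        using pseudo_divmod[OF g(1) qr] by (simp_all add: C_def)
      have CG: "smult C G = [:C:] * G" by simp
      have C': "[:C:] \<noteq> 0" using C by simp
      have q: "q \<noteq> 0"
        using div False C less.prems by auto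
      have "degree (g * q) = degree G"
      proof (cases "r = 0")
        case True
        then show ?thesis using div(1) C by (metis add.right_neutral degree_smult_eq)
      next
        case F: False
        then have "degree r < degree (g * q)"
          using div(2) q g by (simp add: degree_mult_eq)
        then have "degree (g * q + r) = degree (g * q)" by (rule degree_add_eq_left)
        then show ?thesis using div(1) C by (metis degree_smult_eq)
      qed
      then have "degree q < degree G" using deg q g by (simp add: degree_mult_eq)
      from less.hyps[OF this q] obtain i G1 G2 where IH: "G1 \<noteq> 0" "G2 \<noteq> 0" "\<rho> (E G1) = 0" "\<rho> (E G2) = 0"
        "fls_subdegree (E q) + fls_subdegree (E G2) = fls_subdegree (E G1) + int i * fls_subdegree (E g)"
        "lead_deg (E q) + lead_deg (E G2) = lead_deg (E G1) + int i * lead_deg (E g)"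
        by blast
      let ?main = "fls_subdegree (E (smult C G)) = fls_subdegree (E (g * q)) \<and>
        lead_deg (E (smult C G)) = lead_deg (E (g * q))"
      let ?rem = "r \<noteq> 0 \<and> fls_subdegree (E (smult C G)) = fls_subdegree (E r) \<and>
        lead_deg (E (smult C G)) = lead_deg (E r)"
      have "?main \<or> ?rem"
      proof (cases "r = 0")
        case True
        then show ?thesis using div(1) by simp
      next
        case F: False
        then have "\<rho> (E r) = 0" using min div(2) by blast
        moreover have "\<rho> (E q) + \<rho> (E G2) = \<rho> (E G1) + int i * \<rho> (E g)"
          unfolding \<rho>_def using arg_cong2[OF IH(5,6), of "\<lambda>a b. u * a + v * b"]
          by (simp add: algebra_simps)
        then have "\<rho> (E (g * q)) = (int i + 1) * \<rho> (E g)"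
          using IH(3,4) by (simp add: \<rho>_def mult g q algebra_simps)
        then have "\<rho> (E (g * q)) \<noteq> 0" using g by simp
        ultimately have "\<not> (fls_subdegree (E (g * q)) = fls_subdegree (E r) \<and>
            lead_deg (E (g * q)) = lead_deg (E r))"
          by (auto simp: \<rho>_def)
        then have "fls_subdegree (E (g * q) + E r) = fls_subdegree (E (g * q)) \<and>
            lead_deg (E (g * q) + E r) = lead_deg (E (g * q)) \<or>
            fls_subdegree (E (g * q) + E r) = fls_subdegree (E r) \<and>
            lead_deg (E (g * q) + E r) = lead_deg (E r)"
          using lead_add[of "E (g * q)" "E r"] F g q by (simp add: E0)
        moreover have "E (smult C G) = E (g * q) + E r" by (simp add: div(1) ring_map_add[OF E])
        ultimately show ?thesis using F by metis
      qed
      then show ?thesis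
      proof
        assume ?main
        then show ?thesis
          using IH C' less.prems const[OF C] g q
          by (intro exI[of _ "Suc i"] exI[of _ G1] exI[of _ "G2 * [:C:]"])
            (simp add: CG mult \<rho>_def algebra_simps del: mult_pCons_left mult_pCons_right)
      next
        assume ?rem
        then show ?thesis
          using C' less.prems const[OF C] min div(2)
          by (intro exI[of _ 0] exI[of _ r] exI[of _ "[:C:]"])
            (simp add: CG mult \<rho>_def algebra_simps del: mult_pCons_left mult_pCons_right)
      qed
    qed
  qed
  then show ?thesis using g by blast
qed

abbreviation "gen1 \<equiv> E [:[:0, 1:]:]"

text \<open>If \<open>gen1\<close> has the trivial pair, its lowest coefficient is a constant, and
  subtracting it makes the order positive.\<close>

lemma shift_exists:
  "\<exists>c. E [:[:- c, 1:]:] \<noteq> 0 \<and> \<not> (fls_subdegree (E [:[:- c, 1:]:]) = 0 \<and> lead_deg (E [:[:- c, 1:]:]) = 0)"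
proof (cases "fls_subdegree gen1 = 0 \<and> lead_deg gen1 = 0")
  case False
  moreover have "gen1 \<noteq> 0" using E_inj by fastforce
  ultimately show ?thesis by (intro exI[of _ 0]) auto
next
  case True
  define c where "c = coeff (gen1 $$ 0) 0"
  have c: "gen1 $$ 0 = [:c:]"
    using True by (simp add: lead_deg_def c_def) (metis degree_eq_zeroE coeff_pCons_0)
  have "[:[:- c, 1:]:] = [:[:0, 1:]:] - [:[:c:]:]" by simp
  then have eq: "E [:[:- c, 1:]:] = gen1 - fls_const [:c:]"
    by (simp only: ring_map_diff[OF E] E_const)
  have nz: "E [:[:- c, 1:]:] \<noteq> 0" using E_inj by fastforce
  have "order_ge gen1 0" using True order_ge_iff[of gen1] E_inj[of "[:[:0, 1:]:]"] by auto
  then have "order_ge (E [:[:- c, 1:]:]) 0"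
    unfolding eq by (intro order_ge_diff) (auto simp: order_ge_def)
  moreover have "E [:[:- c, 1:]:] $$ 0 = 0" unfolding eq by (simp add: c)
  ultimately have "fls_subdegree (E [:[:- c, 1:]:]) \<noteq> 0"
    using nz nth_fls_subdegree_nonzero by metis
  then show ?thesis using nz by auto
qed

text \<open>Expand \<open>C\<close> in powers of \<open>X - c\<close>: the powers have distinct
  multiples of one nonzero pair, so one of the summands decides the pair of the sum.\<close>

lemma lead_polynomial_in_gen1:
  assumes nz: "E [:[:- c, 1:]:] \<noteq> 0"
    and L: "\<not> (fls_subdegree (E [:[:- c, 1:]:]) = 0 \<and> lead_deg (E [:[:- c, 1:]:]) = 0)"
    and C: "C \<noteq> 0"
  shows "\<exists>i::nat. fls_subdegree (E [:C:]) = int i * fls_subdegree (E [:[:- c, 1:]:]) \<and>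
    lead_deg (E [:C:]) = int i * lead_deg (E [:[:- c, 1:]:])"
  using C
proof (induction "degree C" arbitrary: C rule: less_induct)
  case less
  let ?a = "E [:[:- c, 1:]:]"
  have E0: "E G = 0 \<longleftrightarrow> G = 0" for G using E_inj ring_map_0[OF E] by auto
  show ?case
  proof (cases "degree C = 0")
    case True
    then obtain b where "C = [:b:]" by (rule degree_eq_zeroE)
    then show ?thesis using less.prems lead_const[of b] by (intro exI[of _ 0]) (simp add: E_const)
  next
    case False
    define D where "D = synthetic_div C c"
    define b where "b = poly C c"
    have eq: "C = [:- c, 1:] * D + [:b:]"
      using synthetic_div_correct'[of c C] by (simp add: D_def b_def)
    have D: "D \<noteq> 0" using eq False by auto
    have "degree D < degree C" using False by (simp add: D_def degree_synthetic_div)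
    from less.hyps[OF this D] obtain i :: nat where
      i: "fls_subdegree (E [:D:]) = int i * fls_subdegree ?a" "lead_deg (E [:D:]) = int i * lead_deg ?a"
      by blast
    have "[:C:] = [:[:- c, 1:]:] * [:D:] + [:[:b:]:]" using eq by simp
    then have EC: "E [:C:] = ?a * E [:D:] + fls_const [:b:]"
      by (simp only: ring_map_add[OF E] ring_map_mult[OF E] E_const)
    have ED: "E [:D:] \<noteq> 0" using D by (simp add: E0)
    have lead: "fls_subdegree (?a * E [:D:]) = int (Suc i) * fls_subdegree ?a"
      "lead_deg (?a * E [:D:]) = int (Suc i) * lead_deg ?a"
      using i nz ED by (simp_all add: lead_deg_mult algebra_simps)
    show ?thesis
    proof (cases "b = 0")
      case True
      then show ?thesis using lead EC by (intro exI[of _ "Suc i"]) simp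
    next
      case b: False
      have "\<not> (fls_subdegree (?a * E [:D:]) = fls_subdegree (fls_const [:b:]) \<and>
          lead_deg (?a * E [:D:]) = lead_deg (fls_const [:b:]))"
        using L lead_const[OF b] unfolding lead by auto
      from lead_add[OF _ _ this] have "fls_subdegree (E [:C:]) = int (Suc i) * fls_subdegree ?a \<and>
            lead_deg (E [:C:]) = int (Suc i) * lead_deg ?a \<or>
          fls_subdegree (E [:C:]) = 0 \<and> lead_deg (E [:C:]) = 0"
        using nz ED b lead_const[OF b] unfolding lead EC by simp
      then show ?thesis
      proof
        assume "fls_subdegree (E [:C:]) = 0 \<and> lead_deg (E [:C:]) = 0"
        then show ?thesis by (intro exI[of _ 0]) simp
      qed blast
    qed
  qed
qed

end

section \<open>The cone of leading pairs of \<open>B\<close> and the order of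
  \<open>a - c\<close>\<close>

context double_danielewski
begin

lemma ev_B_const: "ev_B [:c:] = ev_Y c"
  unfolding T.ev_def by (rule poly_ev_const[OF Y.ring_map_ev])

lemma ev_B_polynomial: "ev_B [:[:G:]:] = laurent G"
  by (simp add: ev_B_const ev_Y_const)

lemmas ev_B_simps = ring_map_simps[OF T.ring_map_ev]

text \<open>The numbers \<open>i\<close>, \<open>j\<close>, \<open>k\<close>, \<open>l\<close> are
  the exponents of \<open>x\<close>, \<open>z\<close>, \<open>y\<close>, \<open>t\<close> in a
  monomial with the same pair as \<open>f\<close>.\<close>

lemma ev_B_lead:
  assumes "f \<in> range ev_B" "f \<noteq> 0"
  shows "\<exists>(i::nat) (j::nat) (k::nat) (l::nat).
    fls_subdegree f = int i - int k * int d - int l * int (d * degree Q + e) \<and>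
    lead_deg f = int j + int k * int (degree P) + int l * int (degree P * degree Q)"
proof -
  obtain l k where lk: "fls_subdegree f + int l * int (d * degree Q + e) + int k * int d \<ge> 0"
    "P0 ^ (degree Q * l + k) dvd lowest_coeff f"
    using ev_B_leading assms by blast
  have "degree (P0 ^ (degree Q * l + k)) \<le> degree (lowest_coeff f)"
    using lk(2) assms(2) by (intro dvd_imp_degree_le) auto
  then have le: "(degree Q * l + k) * degree P \<le> degree (lowest_coeff f)"
    using P0_nz by (simp add: degree_power_eq P0)
  define j where "j = degree (lowest_coeff f) - (degree Q * l + k) * degree P"
  have "lead_deg f = int j + int ((degree Q * l + k) * degree P)"
    using le by (simp add: lead_deg_def j_def of_nat_diff)
  then have "lead_deg f = int j + int k * int (degree P) + int l * int (degree P * degree Q)"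
    by (simp add: algebra_simps)
  moreover have "fls_subdegree f = int (nat (fls_subdegree f + int l * int (d * degree Q + e) + int k * int d))
      - int k * int d - int l * int (d * degree Q + e)"
    using lk(1) by simp
  ultimately show ?thesis by blast
qed

lemma ev_B_var_T: "ev_B [:0, 1:] \<noteq> 0" "fls_subdegree (ev_B [:0, 1:]) = - int (d * degree Q + e)"
  "lead_deg (ev_B [:0, 1:]) = int (degree P * degree Q)"
proof -
  have eq: "ev_B [:0, 1:] = ev_Y Q * fls_X_intpow (- int e)"
    unfolding T.ev_def by (rule poly_ev_var[OF Y.ring_map_ev])
  have nz: "ev_Y Q \<noteq> 0" "(fls_X_intpow (- int e) :: 'k poly fls) \<noteq> 0"
    by (rule ev_Y_Q) (rule fls_X_intpow_nonzero)
  then show "ev_B [:0, 1:] \<noteq> 0" unfolding eq by (rule no_zero_divisors)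
  show "fls_subdegree (ev_B [:0, 1:]) = - int (d * degree Q + e)"
    unfolding eq fls_subdegree_mult[OF nz] by (simp add: ev_Y_Q)
  have "lead_deg (fls_X_intpow (- int e) :: 'k poly fls) = 0" by (simp add: lead_deg_def)
  then show "lead_deg (ev_B [:0, 1:]) = int (degree P * degree Q)"
    unfolding eq lead_deg_mult[OF nz] using P0_nz
    by (simp add: lead_deg_def ev_Y_Q degree_power_eq P0)
qed

lemma lead_var_X: "laurent var_X \<noteq> 0" "fls_subdegree (laurent var_X :: 'k poly fls) = 1"
  "lead_deg (laurent var_X :: 'k poly fls) = 0"
  using laurent_var_X[of 1, where 'k='k] by (simp_all add: lead_deg_def)

lemma lead_var_Z: "laurent [:0, 1:] = (fls_const [:0, 1:] :: 'k poly fls)"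
  "fls_subdegree (laurent [:0, 1:] :: 'k poly fls) = 0" "lead_deg (laurent [:0, 1:] :: 'k poly fls) = 1"
proof -
  show "laurent [:0, 1:] = (fls_const [:0, 1:] :: 'k poly fls)"
    unfolding laurent_def by (rule poly_ev_var[OF ring_map_laurent_X])
  then show "fls_subdegree (laurent [:0, 1:] :: 'k poly fls) = 0"
    "lead_deg (laurent [:0, 1:] :: 'k poly fls) = 1"
    by (simp_all add: lead_deg_def)
qed

text \<open>
  The pairs attached to elements of \<open>B\<close> lie in the cone spanned by those of \<open>x\<close> and \<open>t\<close>. The
  functional \<open>\<rho>\<close> vanishing at the pair of \<open>a - c\<close> has constant sign on them, so this pair lies on a
  ray of the cone. If it were the ray of \<open>t\<close>, the primitive functional vanishing there would take
  the value \<open>1\<close> on \<open>B\<close>, but \<open>\<sigma>\<close> has only the values \<open>0\<close> and numbers at least \<open>2\<close>.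
\<close>
lemma cylinder_generator_order:
  assumes "two_generators E" and sub: "range E \<subseteq> range ev_B"
    and gen: "\<And>f. f \<in> range ev_B \<Longrightarrow> \<exists>m. E [:[:0, 1:]:] ^ m * f \<in> range E"
  shows "\<exists>c. order_ge (E [:[:- c, 1:]:]) 1"
proof -
  interpret two_generators E by fact
  have E0: "E G = 0 \<longleftrightarrow> G = 0" for G using E_inj ring_map_0[OF E] by auto
  obtain c where c: "E [:[:- c, 1:]:] \<noteq> 0"
    "\<not> (fls_subdegree (E [:[:- c, 1:]:]) = 0 \<and> lead_deg (E [:[:- c, 1:]:]) = 0)"
    using shift_exists by blast
  define L1 L2 where "L1 = fls_subdegree (E [:[:- c, 1:]:])" and "L2 = lead_deg (E [:[:- c, 1:]:])"
  \<comment> \<open>The pair of \<open>t\<close> is \<open>(- N, M)\<close>. Hence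
    \<open>\<sigma>\<close> vanishes at \<open>t\<close> and has the values \<open>M\<close>,
    \<open>N\<close> and \<open>degree P * e\<close> at \<open>x\<close>, \<open>z\<close> and
    \<open>y\<close>, while \<open>\<rho>\<close> vanishes at the pair \<open>(L1, L2)\<close> of
    \<open>a - c\<close>.\<close>
  define N M where "N = int (d * degree Q + e)" and "M = int (degree P * degree Q)"
  define \<rho> where "\<rho> f = (- L2) * fls_subdegree f + L1 * lead_deg f" for f :: "'k poly fls"
  define \<sigma> where "\<sigma> f = M * fls_subdegree f + N * lead_deg f" for f :: "'k poly fls"
  have "4 \<le> degree P * degree Q" using mult_le_mono[OF P(2) Q(2)] by simp
  then have M: "M \<ge> 4" unfolding M_def by linarith
  have N: "N \<ge> 3" unfolding N_def using d e Q(2) mult_le_mono[of 1 d 2 "degree Q"] by linarith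
  have \<sigma>: "\<exists>i j k l. i \<ge> 0 \<and> j \<ge> 0 \<and> k \<ge> 0 \<and> l \<ge> 0 \<and> \<sigma> f = i * M + j * N + k * int (degree P * e) \<and>
      fls_subdegree f = i - k * int d - l * N \<and> lead_deg f = j + k * int (degree P) + l * M"
    if f: "f \<in> range ev_B" "f \<noteq> 0" for f
  proof -
    obtain i j k l :: nat where *: "fls_subdegree f = int i - int k * int d - int l * N"
      "lead_deg f = int j + int k * int (degree P) + int l * M"
      using ev_B_lead[OF f] unfolding N_def M_def by blast
    have "\<sigma> f = int i * M + int j * N + int k * (int (degree P) * N - M * int d)"
      unfolding \<sigma>_def * by (simp add: algebra_simps)
    also have "int (degree P) * N - M * int d = int (degree P * e)"
      by (simp add: M_def N_def algebra_simps)
    finally show ?thesis using * by (metis of_nat_0_le_iff)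
  qed
  have \<rho>_mult: "\<rho> (f * g) = \<rho> f + \<rho> g" if "f \<noteq> 0" "g \<noteq> 0" for f g
    using that by (simp add: \<rho>_def lead_deg_mult algebra_simps)
  have const: "\<rho> (E [:C:]) = 0" if C: "C \<noteq> 0" for C
    using lead_polynomial_in_gen1[OF c C] by (auto simp: \<rho>_def L1_def L2_def)
  have a_nz: "gen1 \<noteq> 0" by (simp add: E0)
  have \<rho>_a: "\<rho> (gen1 ^ m) = 0" for m
  proof (induction m)
    case 0
    then show ?case using const[of 1] by (simp add: one_pCons[symmetric] E_simps)
  next
    case (Suc m)
    then show ?case using const[of "[:0, 1:]"] a_nz by (simp add: \<rho>_mult)
  qed
  \<comment> \<open>A power of \<open>a\<close> moves \<open>f\<close> into \<open>k[a, b]\<close>,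
    and it does not change \<open>\<rho>\<close>, which vanishes on \<open>k[a]\<close>.\<close>
  have reduce: "\<exists>m G. G \<noteq> 0 \<and> E G = gen1 ^ m * f \<and> \<rho> (E G) = \<rho> f"
    if f: "f \<in> range ev_B" "f \<noteq> 0" for f
  proof -
    obtain m G where "E G = gen1 ^ m * f" using gen[OF f(1)] by (metis imageE)
    then show ?thesis using \<rho>_mult[of "gen1 ^ m" f] \<rho>_a a_nz f(2) by (metis E0 add_0 mult_eq_0_iff power_not_zero)
  qed
  define x z where "x = (laurent var_X :: 'k poly fls)" and "z = (laurent [:0, 1:] :: 'k poly fls)"
  have x: "x \<in> range ev_B" "x \<noteq> 0" "fls_subdegree x = 1" "lead_deg x = 0"
    using lead_var_X unfolding x_def by (metis ev_B_polynomial rangeI)+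
  have "z \<in> range ev_B" unfolding z_def by (metis ev_B_polynomial rangeI)
  moreover have "z \<noteq> 0" by (simp add: z_def)
  ultimately have z: "z \<in> range ev_B" "z \<noteq> 0" "fls_subdegree z = 0" "lead_deg z = 1"
    unfolding z_def by (simp_all only: lead_var_Z(2,3) simp_thms)
  have "\<rho> x \<noteq> 0 \<or> \<rho> z \<noteq> 0" using c(2) by (auto simp: \<rho>_def x z L1_def L2_def)
  then have ex: "\<exists>G. G \<noteq> 0 \<and> \<rho> (E G) \<noteq> 0" using reduce x z by metis
  obtain g where g: "g \<noteq> 0" "\<rho> (E g) \<noteq> 0" and gens: "\<And>G. G \<noteq> 0 \<Longrightarrow> \<exists>(i::nat) G1 G2. G1 \<noteq> 0 \<and> G2 \<noteq> 0 \<and>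
    \<rho> (E G1) = 0 \<and> \<rho> (E G2) = 0 \<and>
    fls_subdegree (E G) + fls_subdegree (E G2) = fls_subdegree (E G1) + int i * fls_subdegree (E g) \<and>
    lead_deg (E G) + lead_deg (E G2) = lead_deg (E G1) + int i * lead_deg (E g)"
    using leading_terms_generated[OF \<rho>_def const ex] by blast
  have multiple: "\<exists>(i::nat) f1 f2. f1 \<in> range ev_B \<and> f2 \<in> range ev_B \<and> f1 \<noteq> 0 \<and> f2 \<noteq> 0 \<and>
      \<rho> f1 = 0 \<and> \<rho> f2 = 0 \<and> \<rho> f = int i * \<rho> (E g) \<and>
      fls_subdegree f + fls_subdegree f2 = fls_subdegree f1 + int i * fls_subdegree (E g) \<and>
      lead_deg f + lead_deg f2 = lead_deg f1 + int i * lead_deg (E g)"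
    if f: "f \<in> range ev_B" "f \<noteq> 0" for f
  proof -
    obtain m G where G: "G \<noteq> 0" "E G = gen1 ^ m * f" using reduce[OF f] by blast
    obtain i :: nat and G1 G2 where G12: "G1 \<noteq> 0" "G2 \<noteq> 0" "\<rho> (E G1) = 0" "\<rho> (E G2) = 0"
      "fls_subdegree (E G) + fls_subdegree (E G2) = fls_subdegree (E G1) + int i * fls_subdegree (E g)"
      "lead_deg (E G) + lead_deg (E G2) = lead_deg (E G1) + int i * lead_deg (E g)"
      using gens[OF G(1)] by blast
    let ?f2 = "gen1 ^ m * E G2"
    have eqs: "fls_subdegree f + fls_subdegree ?f2 = fls_subdegree (E G1) + int i * fls_subdegree (E g)"
      "lead_deg f + lead_deg ?f2 = lead_deg (E G1) + int i * lead_deg (E g)"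
      using G12(2,5,6) f(2) a_nz G(2) by (simp_all add: E0 lead_deg_mult fls_subdegree_mult)
    have f2: "\<rho> ?f2 = 0" using \<rho>_mult[of "gen1 ^ m" "E G2"] \<rho>_a a_nz G12 by (simp add: E0)
    have "\<rho> f + \<rho> ?f2 = \<rho> (E G1) + int i * \<rho> (E g)"
      unfolding \<rho>_def using arg_cong2[OF eqs, of "\<lambda>a b. (- L2) * a + L1 * b"]
      by (simp add: algebra_simps)
    moreover have "?f2 \<in> range E"
      using rangeI[of E "[:[:0, 1:]:] ^ m * G2"] by (simp add: E_simps)
    ultimately show ?thesis
      using eqs f2 G12 sub a_nz
      by (intro exI[of _ i] exI[of _ "E G1"] exI[of _ ?f2]) (auto simp: E0)
  qed
  have t: "ev_B [:0, 1:] \<noteq> 0" "\<rho> (ev_B [:0, 1:]) = L1 * M + L2 * N"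
    by (rule ev_B_var_T) (simp add: \<rho>_def ev_B_var_T(2,3)[folded N_def M_def])
  have "\<rho> x * \<rho> (ev_B [:0, 1:]) \<ge> 0"
  proof -
    obtain i i' :: nat where "\<rho> x = int i * \<rho> (E g)" "\<rho> (ev_B [:0, 1:]) = int i' * \<rho> (E g)"
      using multiple[OF x(1,2)] multiple[OF rangeI t(1)] by blast
    then have "\<rho> x * \<rho> (ev_B [:0, 1:]) = int (i * i') * (\<rho> (E g) * \<rho> (E g))" by simp
    then show ?thesis by simp
  qed
  \<comment> \<open>Both factors will be nonnegative because \<open>a - c\<close> lies in
    \<open>B\<close>, so one of them vanishes: \<open>L2 = 0\<close> is the ray of \<open>x\<close>,
    and \<open>L1 * M + L2 * N = 0\<close> the ray of \<open>t\<close>.\<close>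
  then have sign: "L2 * (L1 * M + L2 * N) \<le> 0" unfolding t by (simp add: \<rho>_def x)
  have "E [:[:- c, 1:]:] \<in> range ev_B" using sub by blast
  from \<sigma>[OF this c(1)] obtain i j k l where ijkl: "i \<ge> 0" "j \<ge> 0" "k \<ge> 0" "l \<ge> 0"
    "L1 * M + L2 * N = i * M + j * N + k * int (degree P * e)" "L2 = j + k * int (degree P) + l * M"
    unfolding \<sigma>_def L1_def L2_def by (metis mult.commute)
  have L2: "L2 \<ge> 0" unfolding ijkl(6) using ijkl M by simp
  have ge: "L1 * M + L2 * N \<ge> 0" unfolding ijkl(5) using ijkl M N by simp
  have "L2 = 0"
  proof (rule ccontr)
    assume "L2 \<noteq> 0"
    then have pos: "L2 > 0" using L2 by simp
    then have zero: "L1 * M + L2 * N = 0" using sign ge by (metis mult_pos_pos not_le order_le_less)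
    have on_ray: "\<exists>l. fls_subdegree f = - l * N \<and> lead_deg f = l * M"
      if f: "f \<in> range ev_B" "f \<noteq> 0" "\<rho> f = 0" for f
    proof -
      have "L2 * \<sigma> f = M * (L2 * fls_subdegree f) + L2 * N * lead_deg f" by (simp add: \<sigma>_def algebra_simps)
      also have "L2 * fls_subdegree f = L1 * lead_deg f" using f(3) by (simp add: \<rho>_def)
      also have "M * (L1 * lead_deg f) + L2 * N * lead_deg f = (L1 * M + L2 * N) * lead_deg f"
        by (simp add: algebra_simps)
      finally have \<sigma>0: "\<sigma> f = 0" using zero pos by simp
      obtain i j k l where *: "i \<ge> 0" "j \<ge> 0" "k \<ge> 0" "l \<ge> 0" "\<sigma> f = i * M + j * N + k * int (degree P * e)"
        "fls_subdegree f = i - k * int d - l * N" "lead_deg f = j + k * int (degree P) + l * M"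
        using \<sigma>[OF f(1,2)] by blast
      have "i * M \<ge> 0" "j * N \<ge> 0" "k * int (degree P * e) \<ge> 0" using * M N by simp_all
      then have "i * M = 0" "j * N = 0" "k * int (degree P * e) = 0" using * \<sigma>0 by linarith+
      then have "i = 0" "j = 0" "k = 0" using M N P(2) e by auto
      then show ?thesis using * by (intro exI[of _ l]) simp
    qed
    have combos: "\<exists>s i. fls_subdegree f = - s * N + i * fls_subdegree (E g) \<and>
        lead_deg f = s * M + i * lead_deg (E g)" if f: "f \<in> range ev_B" "f \<noteq> 0" for f
    proof -
      obtain i f1 f2 where *: "f1 \<in> range ev_B" "f2 \<in> range ev_B" "f1 \<noteq> 0" "f2 \<noteq> 0"
        "\<rho> f1 = 0" "\<rho> f2 = 0"
        "fls_subdegree f + fls_subdegree f2 = fls_subdegree f1 + int i * fls_subdegree (E g)"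
        "lead_deg f + lead_deg f2 = lead_deg f1 + int i * lead_deg (E g)"
        using multiple[OF f] by blast
      obtain l1 l2 where "fls_subdegree f1 = - l1 * N" "lead_deg f1 = l1 * M"
        "fls_subdegree f2 = - l2 * N" "lead_deg f2 = l2 * M"
        using on_ray * by metis
      then show ?thesis using *(7,8)
        by (intro exI[of _ "l1 - l2"] exI[of _ "int i"]) (simp add: algebra_simps)
    qed
    \<comment> \<open>The pairs \<open>(1, 0)\<close> of \<open>x\<close> and \<open>(0, 1)\<close>
      of \<open>z\<close> are integral combinations of \<open>(- N, M)\<close> and the pair of
      \<open>E g\<close>. These two therefore have determinant 1 or -1, and the determinant is
      \<open>- \<sigma> (E g)\<close>.\<close>
    obtain s i where si: "1 = - s * N + i * fls_subdegree (E g)" "0 = s * M + i * lead_deg (E g)"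
      using combos[OF x(1,2)] x(3,4) by metis
    obtain s' i' where si': "0 = - s' * N + i' * fls_subdegree (E g)" "1 = s' * M + i' * lead_deg (E g)"
      using combos[OF z(1,2)] z(3,4) by metis
    have "(i * s' - s * i') * \<sigma> (E g) = (- s * N + i * fls_subdegree (E g)) * (s' * M + i' * lead_deg (E g))
        - (s * M + i * lead_deg (E g)) * (- s' * N + i' * fls_subdegree (E g))"
      by (simp add: \<sigma>_def algebra_simps)
    also have "\<dots> = 1" unfolding si[symmetric] si'[symmetric] by simp
    finally have unit: "\<sigma> (E g) dvd 1" by (metis dvd_triv_right)
    have "E g \<in> range ev_B" "E g \<noteq> 0" using sub g by (auto simp: E0)
    from \<sigma>[OF this] obtain i j k where *: "i \<ge> 0" "j \<ge> 0" "k \<ge> 0"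
      "\<sigma> (E g) = i * M + j * N + k * int (degree P * e)" by blast
    have pe: "int (degree P * e) \<ge> 2" using P(2) e mult_le_mono[of 2 "degree P" 1 e] by linarith
    have prods: "i = 0 \<or> i * M \<ge> 4" "j = 0 \<or> j * N \<ge> 3" "k = 0 \<or> k * int (degree P * e) \<ge> 2"
      using * M N pe mult_mono[of 1 i 4 M] mult_mono[of 1 j 3 N] mult_mono[of 1 k 2 "int (degree P * e)"]
      by force+
    have nonneg: "i * M \<ge> 0" "j * N \<ge> 0" "k * int (degree P * e) \<ge> 0" using * M N by simp_all
    have "\<sigma> (E g) = 0 \<or> \<sigma> (E g) \<ge> 2"
      unfolding *(4) using prods nonneg by (elim disjE) (simp, linarith+)
    then show False using unit by (auto dest: zdvd_imp_le)
  qed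
  moreover have "L1 \<noteq> 0" using c(2) calculation by (simp add: L1_def L2_def)
  ultimately have "L1 > 0" using ge M by (metis add.right_neutral mult_eq_0_iff mult_neg_pos not_less order_le_less mult_zero_left zero_less_numeral order_less_le_trans)
  then show ?thesis using c(1) by (intro exI[of _ c]) (simp add: order_ge_iff L1_def)
qed

end

section \<open>Generators, denominators and monomial factors\<close>

lemma ring_map_generated2:
  fixes g :: "'k::field poly poly \<Rightarrow> 'b::comm_ring_1"
  assumes g: "ring_map g" and add: "\<And>a b. a \<in> S \<Longrightarrow> b \<in> S \<Longrightarrow> a + b \<in> S"
    and mult: "\<And>a b. a \<in> S \<Longrightarrow> b \<in> S \<Longrightarrow> a * b \<in> S"
    and const: "\<And>c. g [:[:c:]:] \<in> S" and gens: "g var_X \<in> S" "g [:0, 1:] \<in> S"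
  shows "g p \<in> S"
proof (induction p)
  case 0
  then show ?case using const[of 0] by simp
next
  case (pCons c p)
  have "g [:c:] \<in> S"
  proof (induction c)
    case 0
    then show ?case using const[of 0] by simp
  next
    case (pCons b c)
    have "[:pCons b c:] = [:[:b:]:] + var_X * [:c:]" by simp
    then have "g [:pCons b c:] = g [:[:b:]:] + g var_X * g [:c:]"
      by (simp only: ring_map_add[OF g] ring_map_mult[OF g])
    then show ?case using pCons.IH by (simp add: add mult const gens)
  qed
  moreover have "pCons c p = [:c:] + [:0, 1:] * p" by simp
  then have "g (pCons c p) = g [:c:] + g [:0, 1:] * g p"
    by (simp only: ring_map_add[OF g] ring_map_mult[OF g])
  ultimately show ?case using pCons.IH by (simp add: add mult gens)
qed

lemma ring_map_generated3:
  fixes g :: "'k::field poly poly poly \<Rightarrow> 'b::comm_ring_1"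
  assumes g: "ring_map g" and add: "\<And>a b. a \<in> S \<Longrightarrow> b \<in> S \<Longrightarrow> a + b \<in> S"
    and mult: "\<And>a b. a \<in> S \<Longrightarrow> b \<in> S \<Longrightarrow> a * b \<in> S"
    and coeffs: "\<And>G. g [:G:] \<in> S" and gen: "g [:0, 1:] \<in> S"
  shows "g p \<in> S"
proof (induction p)
  case 0
  then show ?case using coeffs[of 0] by simp
next
  case (pCons c p)
  have "pCons c p = [:c:] + [:0, 1:] * p" by simp
  then have "g (pCons c p) = g [:c:] + g [:0, 1:] * g p"
    by (simp only: ring_map_add[OF g] ring_map_mult[OF g])
  then show ?case using pCons.IH by (simp add: add mult coeffs gen)
qed

text \<open>Modulo the relation, a factor \<open>x ^ e\<close> trades one occurrence of the variable
  for \<open>u\<close>, so enough of them leave a constant polynomial.\<close>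

lemma clear_denominators:
  fixes x u :: "'r::comm_ring_1" and p :: "'r poly"
  shows "\<exists>m G q. [:x ^ m:] * p = [:G:] + q * ([:x ^ e:] * [:0, 1:] - [:u:])"
proof (induction p)
  case 0
  show ?case by (intro exI[of _ 0]) simp
next
  case (pCons c p)
  let ?g = "[:x ^ e:] * [:0, 1:] - [:u:]"
  obtain m G q where IH: "[:x ^ m:] * p = [:G:] + q * ?g" using pCons.IH by blast
  have "[:x ^ (m + e):] * pCons c p = [:x ^ (m + e) * c:] + [:x ^ e:] * [:0, 1:] * ([:x ^ m:] * p)"
    by (simp add: power_add mult_ac smult_add_right)
  also have "\<dots> = [:x ^ (m + e) * c:] + ([:u:] + ?g) * ([:G:] + q * ?g)" unfolding IH by simp
  also have "\<dots> = [:x ^ (m + e) * c:] + [:u:] * [:G:] + ([:G:] + ([:u:] + ?g) * q) * ?g"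
    by (simp only: algebra_simps)
  also have "[:x ^ (m + e) * c:] + [:u:] * [:G:] = [:x ^ (m + e) * c + u * G:]" by simp
  finally show ?case by blast
qed

text \<open>Both factors have degree 0 in \<open>Z\<close>. In \<open>k[X]\<close> the order at 0 is
  at most the degree for each factor, and orders as well as degrees add up to \<open>M\<close>, so
  they agree.\<close>

lemma monomial_factor:
  fixes g1 g2 :: "'k::field poly poly"
  assumes "g1 * g2 = var_X ^ M"
  shows "\<exists>b j. b \<noteq> 0 \<and> g1 = [:[:b:]:] * var_X ^ j"
proof -
  have "g1 * g2 \<noteq> 0" using assms by simp
  then have nz: "g1 \<noteq> 0" "g2 \<noteq> 0" by auto
  have "degree (g1 * g2) = 0" unfolding assms var_X_power by simp
  then have deg: "degree g1 = 0" "degree g2 = 0" using nz by (simp_all add: degree_mult_eq)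
  then obtain h1 h2 where h: "g1 = [:h1:]" "g2 = [:h2:]" by (metis degree_eq_zeroE)
  have prod: "h1 * h2 = monom 1 M" using assms by (simp add: h var_X_power mult.commute)
  have nz': "h1 \<noteq> 0" "h2 \<noteq> 0" using nz h by auto
  have "Polynomial.order 0 h1 + Polynomial.order 0 h2 = M"
    using order_mult[of h1 h2 0] nz' by (simp add: prod order_0_monom)
  moreover have "degree h1 + degree h2 = M"
    using degree_mult_eq[OF nz'] by (simp add: prod degree_monom_eq)
  ultimately have ord: "Polynomial.order 0 h1 = degree h1"
    using order_degree[OF nz'(1), of 0] order_degree[OF nz'(2), of 0] by linarith
  obtain r where r: "h1 = [:0, 1:] ^ degree h1 * r"
    using order_1[of 0 h1] ord by (auto elim: dvdE)
  have "r \<noteq> 0" using r nz' by auto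
  then have "degree h1 = degree h1 + degree r"
    using arg_cong[OF r, of degree] by (simp add: degree_mult_eq degree_power_eq)
  then obtain b where "r = [:b:]" by (metis add_cancel_right_right degree_eq_zeroE)
  then show ?thesis using \<open>r \<noteq> 0\<close> r h
    by (intro exI[of _ b] exI[of _ "degree h1"]) (auto simp: poly_const_pow mult.commute)
qed

section \<open>The fibre over zero\<close>

lemma ring_map_fls_const: "ring_map (fls_const :: 'c::comm_ring_1 \<Rightarrow> 'c fls)"
  by (simp add: ring_map_def fls_plus_const)

lemma ring_map_comp: "ring_map g \<Longrightarrow> ring_map h \<Longrightarrow> ring_map (\<lambda>c. g (h c))"
  by (simp add: ring_map_def)

lemma ring_map_pCons: "ring_map (\<lambda>c. [:c:])"
  by (simp add: ring_map_def one_pCons)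

lemma ring_map_poly_in_Z: "ring_map (poly_in_Z :: 'k::field poly \<Rightarrow> 'k poly poly)"
proof -
  have eq: "(poly_in_Z :: 'k poly \<Rightarrow> _) = poly_ev (\<lambda>c. [:[:c:]:]) [:0, 1:]"
  proof (rule ext)
    fix c :: "'k poly"
    show "poly_in_Z c = poly_ev (\<lambda>c. [:[:c:]:]) [:0, 1:] c"
    proof (induction c)
      case (pCons a c)
      then show ?case
        by (simp add: poly_in_Z_def map_poly_pCons
            poly_ev_pCons[OF ring_map_comp[OF ring_map_pCons ring_map_pCons]])
    qed (simp add: poly_in_Z_def poly_ev_0)
  qed
  show ?thesis
    unfolding eq by (rule ring_map_poly_ev[OF ring_map_comp[OF ring_map_pCons ring_map_pCons]])
qed

lemma pcompose_eq_poly_ev: "poly_ev (\<lambda>a. [:a:]) w p = pcompose p w"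
  by (simp add: poly_ev_def pcompose_altdef)

text \<open>
  A polynomial ring in \<open>T\<close> over \<open>K[Y] / (q)\<close>, \<open>deg q \<ge> 2\<close>, is not generated by one element \<open>w\<close>:
  modulo a root of \<open>q\<close>, \<open>w\<close> is a nonconstant polynomial in \<open>T\<close>, whence \<open>Y\<close> would be a constant.
\<close>
lemma not_generated_by_one:
  fixes q :: "'K::alg_closed_field poly" and w W1 W2 :: "'K poly poly" and G1 G2 :: "'K poly"
  assumes q: "degree q \<ge> 2"
    and eq1: "[:[:0, 1:]:] = poly_ev (\<lambda>a. [:[:a:]:]) w G1 + W1 * [:q:]"
    and eq2: "[:0, 1:] = poly_ev (\<lambda>a. [:[:a:]:]) w G2 + W2 * [:q:]"
  shows False
proof -
  obtain \<eta> where \<eta>: "poly q \<eta> = 0" using alg_closed_imp_poly_has_root[of q] q by auto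
  define \<tau> where "\<tau> = poly_ev (\<lambda>p. [:poly p \<eta>:]) [:0, 1:]"
  have base: "ring_map (\<lambda>p. [:poly p \<eta>:])" by (simp add: ring_map_def one_pCons)
  have \<tau>: "ring_map \<tau>" unfolding \<tau>_def by (rule ring_map_poly_ev[OF base])
  have \<tau>_const: "\<tau> [:p:] = [:poly p \<eta>:]" for p unfolding \<tau>_def by (rule poly_ev_const[OF base])
  have \<tau>_var: "\<tau> [:0, 1:] = [:0, 1:]" unfolding \<tau>_def by (rule poly_ev_var[OF base])
  have \<tau>_ev: "\<tau> (poly_ev (\<lambda>a. [:[:a:]:]) w G) = pcompose G (\<tau> w)" for G
    unfolding ring_map_poly_ev_ring_map[OF \<tau> ring_map_comp[OF ring_map_pCons ring_map_pCons]]
    by (simp add: \<tau>_const pcompose_eq_poly_ev)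
  have "[:\<eta>:] = pcompose G1 (\<tau> w)"
    using arg_cong[OF eq1, of \<tau>] unfolding ring_map_add[OF \<tau>] ring_map_mult[OF \<tau>]
    by (simp add: \<tau>_ev \<tau>_const \<eta>)
  then have d1: "degree G1 * degree (\<tau> w) = 0" by (metis degree_pCons_0 degree_pcompose)
  have "[:0, 1:] = pcompose G2 (\<tau> w)"
    using arg_cong[OF eq2, of \<tau>] unfolding ring_map_add[OF \<tau>] ring_map_mult[OF \<tau>]
    by (simp add: \<tau>_ev \<tau>_const \<tau>_var \<eta>)
  then have "degree G2 * degree (\<tau> w) = 1" by (metis degree_pCons_0 degree_pCons_eq degree_pcompose one_neq_zero one_pCons pCons_eq_0_iff One_nat_def)
  then have "degree G1 = 0" using d1 by auto
  then obtain b where "G1 = [:b:]" by (rule degree_eq_zeroE)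
  then have "[:[:0, 1:]:] = [:[:b:]:] + W1 * [:q:]"
    using eq1 by (simp add: poly_ev_const[OF ring_map_comp[OF ring_map_pCons ring_map_pCons]])
  \<comment> \<open>The constant coefficient in \<open>T\<close> shows that \<open>q\<close> divides
    the linear polynomial \<open>Y - b\<close>.\<close>
  from arg_cong[OF this, of "\<lambda>p. coeff p 0"] have "[:0, 1:] = [:b:] + coeff W1 0 * q"
    by (simp add: mult.commute[of W1] mult.commute[of _ q])
  then have "[:0, 1:] - [:b:] = coeff W1 0 * q" by (simp only: add_diff_cancel_left')
  then have "[:- b, 1:] = coeff W1 0 * q" by simp
  then have "degree (coeff W1 0 * q) = 1" by (metis degree_pCons_0 degree_pCons_eq pCons_eq_0_iff zero_neq_one One_nat_def)
  moreover from this have "coeff W1 0 \<noteq> 0" "q \<noteq> 0" by auto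
  ultimately show False using q by (simp add: degree_mult_eq)
qed

section \<open>Specialization of the fibre over an algebraic closure\<close>

context double_danielewski
begin

definition rel1 :: "'k poly poly poly poly" where
  "rel1 = [:[:var_X ^ d:] * [:0, 1:] - [:P:]:]"

definition rel2 :: "'k poly poly poly poly" where
  "rel2 = [:[:var_X ^ e:]:] * [:0, 1:] - [:Q:]"

text \<open>Evaluation at \<open>X = 0\<close> and \<open>Z = \<zeta>\<close>. The closure provides
  a root of \<open>P(0, Z)\<close> and later one of the specialized \<open>Q\<close>.\<close>

definition specialize :: "'k alg_closure \<Rightarrow> 'k poly poly \<Rightarrow> 'k alg_closure" where
  "specialize \<zeta> = poly_ev (\<lambda>p. to_ac (poly p 0)) \<zeta>"

lemma ring_map_specialize: "ring_map (specialize \<zeta>)"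
  unfolding specialize_def by (rule ring_map_poly_ev) (simp add: ring_map_def)

lemma specialize_var_X: "n > 0 \<Longrightarrow> specialize \<zeta> (var_X ^ n) = 0"
  unfolding specialize_def var_X_power
  by (subst poly_ev_const) (auto simp: ring_map_def poly_monom)

text \<open>This is \<open>k[z][v] + x B\<close>; if it were all of \<open>B\<close>, then
  \<open>v\<close> would generate \<open>B / x B\<close> over \<open>k[z]\<close>.\<close>

definition approx :: "'k poly fls \<Rightarrow> 'k poly fls set" where
  "approx v = {f. \<exists>G s. s \<in> range ev_B \<and> f = poly_ev fls_const v G + fls_X * s}"

text \<open>Otherwise, setting \<open>x = 0\<close> and sending \<open>z\<close> to a root of
  \<open>P(0, Z)\<close> turns \<open>k[z]\<close> into constants, and both \<open>Y\<close> and
  \<open>T\<close> become polynomials in the image of \<open>v\<close> modulo the specialized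
  \<open>Q\<close>, which is still of degree at least 2 in \<open>Y\<close>.\<close>

lemma approx_proper:
  assumes ker: "\<And>p. ev_B p = 0 \<Longrightarrow> \<exists>U W. p = U * rel1 + W * rel2"
    and v: "v \<in> range ev_B"
  shows "\<not> range ev_B \<subseteq> approx v"
proof
  assume sub: "range ev_B \<subseteq> approx v"
  obtain V where V: "v = ev_B V" using v by blast
  define \<iota> :: "'k poly \<Rightarrow> 'k poly poly poly poly" where "\<iota> c = [:[:poly_in_Z c:]:]" for c
  have \<iota>: "ring_map \<iota>"
    using ring_map_comp[OF ring_map_pCons ring_map_comp[OF ring_map_pCons ring_map_poly_in_Z]]
    by (simp add: \<iota>_def[abs_def])
  have lift: "poly_ev fls_const v G = ev_B (poly_ev \<iota> V G)" for G
    unfolding ring_map_poly_ev_ring_map[OF T.ring_map_ev \<iota>] V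
    by (simp add: \<iota>_def ev_B_polynomial laurent_poly_in_Z)
  have x: "ev_B [:[:var_X:]:] = fls_X"
    using laurent_var_X[of 1] by (simp add: ev_B_polynomial fls_X_conv_shift_1)
  have rep: "\<exists>G H U W. F = poly_ev \<iota> V G + [:[:var_X:]:] * H + U * rel1 + W * rel2" for F
  proof -
    obtain G H where "ev_B F = ev_B (poly_ev \<iota> V G) + ev_B [:[:var_X:]:] * ev_B H"
      using sub lift x by (force simp: approx_def)
    then have "ev_B (F - poly_ev \<iota> V G - [:[:var_X:]:] * H) = 0"
      by (simp only: ring_map_diff[OF T.ring_map_ev] ring_map_mult[OF T.ring_map_ev]) simp
    then obtain U W where "F - poly_ev \<iota> V G - [:[:var_X:]:] * H = U * rel1 + W * rel2"
      using ker by blast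
    then have "F = poly_ev \<iota> V G + [:[:var_X:]:] * H + U * rel1 + W * rel2"
      by (simp only: diff_eq_eq ac_simps)
    then show ?thesis by blast
  qed
  obtain \<zeta> where \<zeta>: "poly (map_poly to_ac P0) \<zeta> = 0"
    using alg_closed_imp_poly_has_root[of "map_poly to_ac P0"] P0 P
    by (auto simp: degree_map_poly)
  define \<psi>1 where "\<psi>1 = specialize \<zeta>"
  have \<psi>1: "ring_map \<psi>1" unfolding \<psi>1_def by (rule ring_map_specialize)
  define \<psi>2 where "\<psi>2 = poly_ev (\<lambda>G. [:\<psi>1 G:]) [:0, 1:]"
  have \<psi>1': "ring_map (\<lambda>G. [:\<psi>1 G:])" by (rule ring_map_comp[OF ring_map_pCons \<psi>1])
  have \<psi>2: "ring_map \<psi>2" unfolding \<psi>2_def by (rule ring_map_poly_ev[OF \<psi>1'])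
  define \<psi>3 where "\<psi>3 = poly_ev (\<lambda>G. [:\<psi>2 G:]) [:0, 1:]"
  have \<psi>2': "ring_map (\<lambda>G. [:\<psi>2 G:])" by (rule ring_map_comp[OF ring_map_pCons \<psi>2])
  have \<psi>3: "ring_map \<psi>3" unfolding \<psi>3_def by (rule ring_map_poly_ev[OF \<psi>2'])
  have ev: "\<psi>3 [:H:] = [:\<psi>2 H:]" "\<psi>2 [:G:] = [:\<psi>1 G:]" "\<psi>3 [:0, 1:] = [:0, 1:]" "\<psi>2 [:0, 1:] = [:0, 1:]" for H G
    unfolding \<psi>3_def \<psi>2_def
    by (rule poly_ev_const[OF \<psi>2'[unfolded \<psi>2_def]] poly_ev_const[OF \<psi>1']
        poly_ev_var[OF \<psi>2'[unfolded \<psi>2_def]] poly_ev_var[OF \<psi>1'])+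
  have "\<psi>1 P = poly_ev (\<lambda>c. c) \<zeta> (map_poly to_ac P0)"
    unfolding \<psi>1_def specialize_def P0_def at_X_0_def poly_ev_def
    by (simp add: map_poly_map_poly o_def)
  then have \<psi>1P: "\<psi>1 P = 0" using \<zeta> by (simp add: poly_ev_def)
  have X0: "\<psi>1 (var_X ^ m) = 0" if "m > 0" for m using specialize_var_X[OF that] by (simp add: \<psi>1_def)
  have r1: "\<psi>3 rel1 = 0"
    using X0[OF d] by (simp only: rel1_def ev ring_map_diff[OF \<psi>2] ring_map_mult[OF \<psi>2] \<psi>1P) simp
  have r2: "\<psi>3 rel2 = - [:\<psi>2 Q:]"
    using X0[OF e] by (simp only: rel2_def ev ring_map_diff[OF \<psi>3] ring_map_mult[OF \<psi>3]) simp
  have x0: "\<psi>3 [:[:var_X:]:] = 0" using X0[of 1] by (simp add: ev)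
  define \<sigma> where "\<sigma> c = \<psi>1 (poly_in_Z c)" for c
  have \<sigma>: "ring_map \<sigma>" unfolding \<sigma>_def by (rule ring_map_comp[OF \<psi>1 ring_map_poly_in_Z])
  have \<psi>_ev: "\<psi>3 (poly_ev \<iota> V G) = poly_ev (\<lambda>a. [:[:a:]:]) (\<psi>3 V) (map_poly \<sigma> G)" for G
    unfolding ring_map_poly_ev_ring_map[OF \<psi>3 \<iota>] \<iota>_def ev
    by (simp add: poly_ev_def map_poly_map_poly o_def \<sigma>_def[symmetric] ring_map_0[OF \<sigma>])
  have q: "degree (\<psi>2 Q) \<ge> 2"
  proof -
    have "\<psi>2 Q = map_poly \<psi>1 Q"
      unfolding \<psi>2_def using pcompose_eq_poly_ev[of "[:0, 1:]" "map_poly \<psi>1 Q"]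
      by (simp add: poly_ev_def map_poly_map_poly o_def ring_map_0[OF \<psi>1])
    then have "coeff (\<psi>2 Q) (degree Q) = 1"
      using Q by (simp add: coeff_map_poly ring_map_0[OF \<psi>1] ring_map_1[OF \<psi>1])
    then have "degree Q \<le> degree (\<psi>2 Q)" by (intro le_degree) simp
    then show ?thesis using Q by simp
  qed
  have spec: "\<exists>G W. \<psi>3 F = poly_ev (\<lambda>a. [:[:a:]:]) (\<psi>3 V) G + W * [:\<psi>2 Q:]" for F
  proof -
    obtain G H U W where "F = poly_ev \<iota> V G + [:[:var_X:]:] * H + U * rel1 + W * rel2"
      using rep by blast
    then have "\<psi>3 F = poly_ev (\<lambda>a. [:[:a:]:]) (\<psi>3 V) (map_poly \<sigma> G) + (- \<psi>3 W) * [:\<psi>2 Q:]"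
      by (simp only: ring_map_add[OF \<psi>3] ring_map_mult[OF \<psi>3] \<psi>_ev r1 r2 x0) simp
    then show ?thesis by blast
  qed
  obtain G1 W1 where eq1: "\<psi>3 [:[:0, 1:]:] = poly_ev (\<lambda>a. [:[:a:]:]) (\<psi>3 V) G1 + W1 * [:\<psi>2 Q:]"
    using spec by blast
  obtain G2 W2 where eq2: "\<psi>3 [:0, 1:] = poly_ev (\<lambda>a. [:[:a:]:]) (\<psi>3 V) G2 + W2 * [:\<psi>2 Q:]"
    using spec by blast
  show False using not_generated_by_one[OF q eq1[unfolded ev] eq2[unfolded ev]] .
qed

end

section \<open>Comparing the two surfaces\<close>

definition ev_A :: "nat \<Rightarrow> 'k::field poly poly \<Rightarrow> 'k poly poly poly \<Rightarrow> 'k poly fls" where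
  "ev_A n f = poly_ev laurent (laurent f * fls_X_intpow (- int n))"

definition rel_A :: "nat \<Rightarrow> 'k::field poly poly \<Rightarrow> 'k poly poly poly" where
  "rel_A n f = [:var_X ^ n:] * [:0, 1:] - [:f:]"

lemma ring_map_ev_A: "ring_map (ev_A n f)"
  unfolding ev_A_def by (rule ring_map_poly_ev[OF ring_map_laurent])

lemma ev_A_const: "ev_A n f [:G:] = laurent G"
  unfolding ev_A_def by (rule poly_ev_const[OF ring_map_laurent])

lemma ev_A_var: "ev_A n f [:0, 1:] = laurent f * fls_X_intpow (- int n)"
  unfolding ev_A_def by (rule poly_ev_var[OF ring_map_laurent])

lemma X_intpow_cancel: "fls_X_intpow a * fls_X_intpow (- a) = (1 :: 'c::idom fls)"
  by (simp only: fls_X_intpow_times_fls_X_intpow add.right_inverse) simp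

lemma ev_A_rel: "ev_A n f (rel_A n f) = 0"
proof -
  have "ev_A n f (rel_A n f) = laurent f * (fls_X_intpow (int n) * fls_X_intpow (- int n)) - laurent f"
    unfolding rel_A_def ring_map_diff[OF ring_map_ev_A] ring_map_mult[OF ring_map_ev_A]
      ev_A_const ev_A_var laurent_var_X by (simp only: mult_ac)
  then show ?thesis by (simp only: X_intpow_cancel) simp
qed

text \<open>The leading coefficient of an element of the kernel is divisible by \<open>X ^ n\<close>, as \<open>f\<close> has order \<open>0\<close>.\<close>
lemma ev_A_kernel:
  assumes f: "at_X_0 f \<noteq> 0" and "ev_A n f p = 0"
  shows "\<exists>q. p = q * rel_A n f"
proof -
  have nth: "laurent f $$ 0 \<noteq> 0" using f by (simp only: laurent_nth_0 not_False_eq_True)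
  then have lf: "laurent f \<noteq> 0" "fls_subdegree (laurent f) = 0"
    by (metis fls_zero_nth) (rule subdegree_eqI_order_ge[OF order_ge_laurent nth])
  let ?v = "laurent f * fls_X_intpow (- int n)"
  have "\<exists>q. p = q * rel_A n f" if "degree p \<le> m" "ev_A n f p = 0" for m
    using that
  proof (induction m arbitrary: p)
    case 0
    then obtain c where "p = [:c:]" by (metis degree_eq_zeroE le_zero_eq)
    then show ?case using 0 by (intro exI[of _ 0]) (simp add: ev_A_const)
  next
    case (Suc m)
    define c where "c = coeff p (Suc m)"
    have sum: "ev_A n f p = (\<Sum>l\<le>m. laurent (coeff p l) * ?v ^ l) + laurent c * ?v ^ Suc m"
      unfolding ev_A_def poly_ev_eq_sum[OF ring_map_laurent Suc.prems(1)] by (simp add: c_def)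
    have "order_ge (laurent (coeff p l) * ?v ^ l) (- int m * int n)" if "l \<le> m" for l
    proof (rule adjoin_term_order(1)[OF lf(1)])
      have "int l * int n \<le> int m * int n" using that by (simp add: mult_right_mono)
      then show "order_ge (laurent (coeff p l)) (- int m * int n - int l * (fls_subdegree (laurent f) - int n))"
        by (intro order_ge_mono[OF order_ge_laurent]) (simp add: lf(2))
    qed
    then have "order_ge (- (\<Sum>l\<le>m. laurent (coeff p l) * ?v ^ l)) (- int m * int n)"
      by (intro order_ge_uminus order_ge_sum) auto
    moreover have "laurent c * ?v ^ Suc m = - (\<Sum>l\<le>m. laurent (coeff p l) * ?v ^ l)"
      using Suc.prems(2) unfolding sum by (simp add: eq_neg_iff_add_eq_0 add.commute)
    ultimately have ord: "order_ge (laurent c * ?v ^ Suc m) (- int m * int n)" by simp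
    have "var_X ^ n dvd c"
    proof (cases "c = 0")
      case False
      have v: "?v \<noteq> 0" "fls_subdegree ?v = - int n"
        using lf fls_X_intpow_nonzero[of "- int n", where ?'a = "'a poly"] by (auto simp: fls_subdegree_mult)
      have "laurent c \<noteq> 0" using False by simp
      then have "- int m * int n \<le> fls_subdegree (laurent c) + int (Suc m) * (- int n)"
        using ord v by (simp only: order_ge_iff no_zero_divisors power_not_zero fls_subdegree_mult
            fls_subdegree_pow not_False_eq_True)
      then have "order_ge (laurent c) (int n)"
        using False by (simp add: order_ge_iff algebra_simps)
      then show ?thesis by (rule order_ge_laurent_dvd)
    qed simp
    then obtain c' where c': "c = var_X ^ n * c'" by (rule dvdE)
    define p' where "p' = p - monom c' m * rel_A n f"
    have eq: "monom c' m * rel_A n f = monom c (Suc m) - monom (c' * f) m"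
      unfolding rel_A_def c' by (simp add: right_diff_distrib monom_Suc smult_monom minus_monom mult_ac)
    have "degree p' \<le> m"
    proof (rule degree_le, intro allI impI)
      fix i assume "m < i"
      then show "coeff p' i = 0"
        using Suc.prems(1) coeff_eq_0[of p i] by (cases "i = Suc m") (auto simp: p'_def eq c_def)
    qed
    moreover have "ev_A n f p' = 0"
      using Suc.prems(2) by (simp only: p'_def ring_map_diff[OF ring_map_ev_A]
          ring_map_mult[OF ring_map_ev_A] ev_A_rel) simp
    ultimately obtain q where "p' = q * rel_A n f" using Suc.IH by blast
    then have "p = (q + monom c' m) * rel_A n f" by (simp add: p'_def algebra_simps)
    then show ?case by blast
  qed
  then show ?thesis using assms(2) by blast
qed

lemma ev_A_clear: "\<exists>m G. \<exists>q. [:var_X ^ m:] * p = [:G:] + q * rel_A n f"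
  unfolding rel_A_def by (rule clear_denominators)

section \<open>The ring \<open>B\<close> and its subrings \<open>k[z][v] + x B\<close>\<close>

context double_danielewski
begin

lemma ev_B_var_X: "ev_B [:[:var_X:]:] = fls_X"
  using laurent_var_X[of 1] by (simp add: ev_B_polynomial fls_X_conv_shift_1)

lemma ev_Y_var: "ev_Y [:0, 1:] = laurent P * fls_X_intpow (- int d)"
  unfolding Y.ev_def by (rule poly_ev_var[OF ring_map_laurent])

lemma ev_B_var: "ev_B [:0, 1:] = ev_Y Q * fls_X_intpow (- int e)"
  unfolding T.ev_def by (rule poly_ev_var[OF Y.ring_map_ev])

lemma ev_B_rel: "ev_B rel1 = 0" "ev_B rel2 = 0"
proof -
  have "ev_B rel1 = laurent P * (fls_X_intpow (int d) * fls_X_intpow (- int d)) - laurent P"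
    unfolding rel1_def ev_B_const ring_map_diff[OF Y.ring_map_ev] ring_map_mult[OF Y.ring_map_ev]
      ev_Y_const laurent_var_X ev_Y_var by (simp only: mult_ac)
  then show "ev_B rel1 = 0" by (simp only: X_intpow_cancel) simp
  have "ev_B rel2 = ev_Y Q * (fls_X_intpow (int e) * fls_X_intpow (- int e)) - ev_Y Q"
    unfolding rel2_def ring_map_diff[OF T.ring_map_ev] ring_map_mult[OF T.ring_map_ev]
      ev_B_const ev_Y_const laurent_var_X ev_B_var
    by (simp only: mult_ac)
  then show "ev_B rel2 = 0" by (simp only: X_intpow_cancel) simp
qed

lemma const_poly_mult: "[:a:] * [:b:] = [:a * b :: 'c::comm_ring_1:]"
  and const_poly_add: "[:a:] + [:b:] = [:a + b:]"
  by (simp_all add: mult.commute)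

lemma ev_B_clear:
  "\<exists>m G U W. [:[:var_X ^ m:]:] * p = [:[:G:]:] + U * rel1 + W * rel2"
proof -
  obtain m H W where 1: "[:[:var_X:] ^ m:] * p = [:H:] + W * ([:[:var_X:] ^ e:] * [:0, 1:] - [:Q:])"
    using clear_denominators[of "[:var_X:]" p e Q] by blast
  obtain k G U where 2: "[:var_X ^ k:] * H = [:G:] + U * ([:var_X ^ d:] * [:0, 1:] - [:P:])"
    using clear_denominators[of var_X H d P] by blast
  have "[:[:var_X ^ (k + m):]:] * p = [:[:var_X ^ k:]:] * ([:[:var_X:] ^ m:] * p)"
    by (simp only: power_add poly_const_pow const_poly_mult mult.assoc[symmetric])
  also have "\<dots> = [:[:var_X ^ k:] * H:] + [:[:var_X ^ k:]:] * W * rel2"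
    unfolding 1 by (simp only: rel2_def poly_const_pow distrib_left mult.assoc const_poly_mult)
  also have "[:[:var_X ^ k:] * H:] = [:[:G:]:] + [:U:] * rel1"
    unfolding 2 by (simp only: rel1_def const_poly_mult const_poly_add)
  finally show ?thesis by blast
qed

lemma ev_B_clear': "\<exists>m G. fls_X_intpow (int m) * ev_B p = laurent G"
proof -
  obtain m G U W where "[:[:var_X ^ m:]:] * p = [:[:G:]:] + U * rel1 + W * rel2"
    using ev_B_clear by blast
  from arg_cong[OF this, of ev_B] have "fls_X_intpow (int m) * ev_B p = laurent G"
    by (simp only: ring_map_add[OF T.ring_map_ev] ring_map_mult[OF T.ring_map_ev]
        ev_B_rel ev_B_polynomial laurent_var_X) simp
  then show ?thesis by blast
qed

text \<open>For \<open>s = 0\<close> this says that elements of \<open>B\<close> without a pole lie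
  in \<open>k[X, Z]\<close>: a power of \<open>X\<close> carries \<open>f\<close> into
  \<open>k[X, Z]\<close>, where a bound on the order means divisibility by a power of
  \<open>X\<close>.\<close>

lemma ev_B_order_ge:
  assumes "f \<in> range ev_B" "order_ge f (int s)"
  shows "\<exists>G. f = fls_X_intpow (int s) * laurent G"
proof -
  obtain m G where m: "fls_X_intpow (int m) * f = laurent G"
    using ev_B_clear' assms(1) by blast
  have "order_ge (laurent G) (int (m + s))"
    using order_ge_mult[OF order_ge_X_intpow assms(2), of "int m"] by (simp only: m of_nat_add)
  then obtain H where "G = var_X ^ (m + s) * H" using order_ge_laurent_dvd by (metis dvdE)
  then have "fls_X_intpow (int m) * f = laurent (var_X ^ (m + s) * H)" using m by simp
  also have "\<dots> = fls_X_intpow (int m) * (fls_X_intpow (int s) * laurent H)"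
    by (simp only: ring_map_mult[OF ring_map_laurent] laurent_var_X of_nat_add mult.assoc
        fls_X_intpow_times_fls_X_intpow[symmetric])
  finally show ?thesis using fls_X_intpow_nonzero mult_cancel_left by metis
qed

lemma B_add: "f \<in> range ev_B \<Longrightarrow> g \<in> range ev_B \<Longrightarrow> f + g \<in> range ev_B"
  by (auto simp flip: ring_map_add[OF T.ring_map_ev])

lemma B_mult: "f \<in> range ev_B \<Longrightarrow> g \<in> range ev_B \<Longrightarrow> f * g \<in> range ev_B"
  by (auto simp flip: ring_map_mult[OF T.ring_map_ev])

lemma B_laurent: "laurent G \<in> range ev_B"
  by (metis ev_B_polynomial rangeI)

lemma B_X: "fls_X \<in> range ev_B"
  by (metis ev_B_var_X rangeI)

lemma B_const: "fls_const c \<in> range ev_B"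
  by (metis B_laurent laurent_poly_in_Z)

lemma B_poly_ev: "v \<in> range ev_B \<Longrightarrow> poly_ev fls_const v G \<in> range ev_B"
proof (induction G)
  case 0
  then show ?case using B_const[of 0] by (simp add: poly_ev_0)
next
  case (pCons c G)
  then show ?case by (simp add: poly_ev_pCons[OF ring_map_fls_const] B_add B_mult B_const)
qed

context
  fixes v assumes v: "v \<in> range ev_B"
begin

lemma approxI: "s \<in> range ev_B \<Longrightarrow> poly_ev fls_const v G + fls_X * s \<in> approx v"
  by (auto simp: approx_def)

lemma approx_add:
  assumes "f \<in> approx v" "g \<in> approx v"
  shows "f + g \<in> approx v"
proof -
  obtain F s G t where "s \<in> range ev_B" "t \<in> range ev_B"
    "f = poly_ev fls_const v F + fls_X * s" "g = poly_ev fls_const v G + fls_X * t"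
    using assms unfolding approx_def by blast
  then show ?thesis
    using approxI[OF B_add, of s t "F + G"]
    by (simp add: ring_map_add[OF ring_map_poly_ev[OF ring_map_fls_const]] algebra_simps)
qed

lemma approx_mult:
  assumes "f \<in> approx v" "g \<in> approx v"
  shows "f * g \<in> approx v"
proof -
  let ?e = "poly_ev fls_const v"
  obtain F s G t where st: "s \<in> range ev_B" "t \<in> range ev_B"
    "f = ?e F + fls_X * s" "g = ?e G + fls_X * t"
    using assms unfolding approx_def by blast
  have "?e F * t + s * (?e G + fls_X * t) \<in> range ev_B"
    using st v by (intro B_add B_mult B_poly_ev B_X)
  then have "?e (F * G) + fls_X * (?e F * t + s * (?e G + fls_X * t)) \<in> approx v" by (rule approxI)
  also have "?e (F * G) + fls_X * (?e F * t + s * (?e G + fls_X * t)) = f * g"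
    by (simp add: st ring_map_mult[OF ring_map_poly_ev[OF ring_map_fls_const]] algebra_simps)
  finally show ?thesis .
qed

lemma approx_X_mult: "s \<in> range ev_B \<Longrightarrow> fls_X * s \<in> approx v"
  using approxI[of s 0] by (simp add: poly_ev_0)

lemma approx_const: "fls_const c \<in> approx v"
  using approxI[OF B_const[of 0], of "[:c:]"] by (simp add: poly_ev_const[OF ring_map_fls_const])

lemma approx_var: "v \<in> approx v"
  using approxI[OF B_const[of 0], of "[:0, 1:]"] by (simp add: poly_ev_var[OF ring_map_fls_const])

lemma approx_laurent: "laurent G \<in> approx v"
proof (rule ring_map_generated2[OF ring_map_laurent])
  show "laurent var_X \<in> approx v"
    using approx_X_mult[of 1] B_const[of 1] ev_B_var_X by (simp add: ev_B_polynomial)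
  show "laurent [:0, 1:] \<in> approx v" by (simp add: lead_var_Z approx_const)
qed (simp_all add: approx_add approx_mult laurent_const approx_const)

end

text \<open>Here \<open>\<theta>\<close> is the isomorphism pulled back to
  \<open>k[X, Z, V]\<close>; with the kernel of \<open>ev_A\<close> and the image \<open>B\<close>,
  it identifies the two rings inside Laurent series.\<close>

theorem no_isomorphism:
  fixes \<theta> :: "'k poly poly poly \<Rightarrow> 'k poly fls"
  assumes ker: "\<And>p. ev_B p = 0 \<Longrightarrow> \<exists>U W. p = U * rel1 + W * rel2"
    and \<theta>: "ring_map \<theta>" and const: "\<And>c. \<theta> [:[:[:c:]:]:] = fls_const [:c:]"
    and range: "range \<theta> = range ev_B" and \<theta>_ker: "\<And>p. \<theta> p = 0 \<longleftrightarrow> ev_A n f p = 0"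
  shows False
proof -
  define E where "E G = \<theta> [:G:]" for G
  define a b v where "a = \<theta> [:var_X:]" and "b = \<theta> [:[:0, 1:]:]" and "v = \<theta> [:0, 1:]"
  have E: "ring_map E" unfolding E_def by (rule ring_map_comp[OF \<theta> ring_map_pCons])
  have E_const: "E [:[:c:]:] = fls_const [:c:]" for c by (simp add: E_def const)
  have inj: "G = 0" if "E G = 0" for G
    using that \<theta>_ker[of "[:G:]"] by (simp add: E_def ev_A_const)
  interpret two_generators E by unfold_locales (use E inj E_const in auto)
  have gen1: "gen1 = a" and E_b: "E [:0, 1:] = b" by (simp_all add: a_def b_def E_def)
  have \<theta>B: "\<theta> p \<in> range ev_B" for p using range by blast
  have B\<theta>: "\<exists>p. f = \<theta> p" if "f \<in> range ev_B" for f using range that by (metis imageE)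
  have E_B: "E G \<in> range ev_B" for G by (simp add: E_def \<theta>B)
  have a0: "a \<noteq> 0" using inj[of "[:[:0, 1:]:]"] by (auto simp: gen1)
  have a_pow: "\<theta> [:var_X ^ m:] = a ^ m" for m
    unfolding a_def ring_map_power[OF \<theta>, symmetric] by (simp add: poly_const_pow)
  have \<theta>_rel: "\<theta> (rel_A n f) = 0" using \<theta>_ker ev_A_rel by blast
  have gen: "\<exists>m. gen1 ^ m * g \<in> range E" if g: "g \<in> range ev_B" for g
  proof -
    obtain p where p: "g = \<theta> p" using B\<theta>[OF g] by blast
    obtain m G q where "[:var_X ^ m:] * p = [:G:] + q * rel_A n f" using ev_A_clear by blast
    from arg_cong[OF this, of \<theta>] have "a ^ m * g = E G"
      unfolding ring_map_mult[OF \<theta>] ring_map_add[OF \<theta>] \<theta>_rel a_pow p[symmetric] E_def by simp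
    then show ?thesis unfolding gen1 by blast
  qed
  obtain c where c: "order_ge (E [:[:- c, 1:]:]) 1"
    using cylinder_generator_order[of E] two_generators_axioms E_B gen by blast
  have "[:[:- c, 1:]:] = [:[:0, 1:]:] - [:[:c:]:]" by simp
  then have ac: "E [:[:- c, 1:]:] = a - fls_const [:c:]"
    by (simp only: ring_map_diff[OF E] E_const gen1)
  obtain H where "E [:[:- c, 1:]:] = fls_X_intpow (int 1) * laurent H"
    using ev_B_order_ge[OF E_B, of _ 1] c by (metis of_nat_1)
  then have a_eq: "a = fls_const [:c:] + fls_X * laurent H"
    unfolding ac by (simp add: fls_X_conv_shift_1 algebra_simps)
  have all_approx: "range ev_B \<subseteq> approx w"
    if w: "w \<in> range ev_B" and "a \<in> approx w" "b \<in> approx w"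
      and vw: "(\<And>G. E G \<in> approx w) \<Longrightarrow> v \<in> approx w" for w
  proof -
    note closed = approx_add[OF w] approx_mult[OF w]
    have EG: "E G \<in> approx w" for G
      by (rule ring_map_generated2[OF E]) (use that in \<open>simp_all add: closed E_const approx_const[OF w] gen1 E_b\<close>)
    have "\<theta> p \<in> approx w" for p
      by (rule ring_map_generated3[OF \<theta>]) (use vw[OF EG] EG in \<open>simp_all add: closed E_def v_def\<close>)
    then have "range \<theta> \<subseteq> approx w" by blast
    then show ?thesis by (simp only: range)
  qed
  show False
  proof (cases "c = 0")
    case False
    have b: "b \<in> range ev_B" by (simp add: b_def \<theta>B)
    have pow: "\<exists>s. s \<in> range ev_B \<and> a ^ m = fls_const [:c ^ m:] + fls_X * s" for m
    proof (induction m)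
      case 0
      then show ?case using B_const[of 0] by (intro exI[of _ 0]) (simp add: one_pCons[symmetric])
    next
      case (Suc m)
      then obtain s where s: "s \<in> range ev_B" "a ^ m = fls_const [:c ^ m:] + fls_X * s" by blast
      have "a ^ Suc m = fls_const [:c:] * fls_const [:c ^ m:] +
          fls_X * (laurent H * a ^ m + fls_const [:c:] * s)"
        unfolding power_Suc by (subst a_eq) (simp add: s algebra_simps del: fls_const_mult_const)
      moreover have "a ^ m \<in> range ev_B" using \<theta>B[of "[:var_X ^ m:]"] by (simp add: a_pow)
      then have "laurent H * a ^ m + fls_const [:c:] * s \<in> range ev_B"
        using s by (intro B_add B_mult B_laurent B_const)
      ultimately show ?case by (intro exI[of _ "laurent H * a ^ m + fls_const [:c:] * s"]) (simp add: mult.commute)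
    qed
    have a: "a \<in> approx b"
      unfolding a_eq by (intro approx_add[OF b] approx_const[OF b] approx_X_mult[OF b] B_laurent)
    \<comment> \<open>From \<open>a ^ n * v = f(a, b)\<close>, where \<open>a\<close> is congruent
      to the nonzero constant \<open>c\<close> modulo \<open>x B\<close>, the class of
      \<open>v\<close> is that of \<open>f(a, b)\<close> divided by \<open>c ^ n\<close>.\<close>
    have v: "v \<in> approx b" if EG: "\<And>G. E G \<in> approx b"
    proof -
      obtain s where s: "s \<in> range ev_B" "a ^ n = fls_const [:c ^ n:] + fls_X * s" using pow by blast
      have "a ^ n * v = E f"
        using \<theta>_rel unfolding rel_A_def ring_map_diff[OF \<theta>] ring_map_mult[OF \<theta>] a_pow
        by (simp add: v_def E_def)
      then have "fls_const [:c ^ n:] * v = E f + fls_X * (fls_const (- 1) * s * v)"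
        unfolding s by (simp add: algebra_simps)
      moreover have "fls_const [:inverse (c ^ n):] * fls_const [:c ^ n:] = 1"
        using False by (simp add: one_pCons[symmetric])
      ultimately have "v = fls_const [:inverse (c ^ n):] * (E f + fls_X * (fls_const (- 1) * s * v))"
        by (metis mult.assoc mult_1)
      moreover have "v \<in> range ev_B" by (simp add: v_def \<theta>B)
      then have "fls_const [:inverse (c ^ n):] * (E f + fls_X * (fls_const (- 1) * s * v)) \<in> approx b"
        using s by (intro approx_mult[OF b] approx_add[OF b] approx_const[OF b] approx_X_mult[OF b] EG B_mult B_const)
      ultimately show ?thesis by simp
    qed
    show ?thesis using all_approx[OF b a approx_var[OF b] v] approx_proper[OF ker b] by blast
  next
    case True
    have aX: "a = fls_X * laurent H" using a_eq True by simp
    \<comment> \<open>The factorization \<open>a = x * laurent H\<close> is transported to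
      \<open>A\<close>, where clearing denominators makes it a factorization of a power of
      \<open>X\<close> in \<open>k[X, Z]\<close>. So \<open>x\<close> is a constant times a quotient
      of powers of \<open>a\<close>, and orders force this quotient to be \<open>a\<close>.\<close>
    obtain \<xi> \<eta> where \<xi>: "fls_X = \<theta> \<xi>" and \<eta>: "laurent H = \<theta> \<eta>"
      using B\<theta>[OF B_X] B\<theta>[OF B_laurent] by blast
    have "\<theta> ([:var_X:] - \<xi> * \<eta>) = 0"
      using aX by (simp add: ring_map_diff[OF \<theta>] ring_map_mult[OF \<theta>] a_def \<xi> \<eta>)
    then have "ev_A n f ([:var_X:] - \<xi> * \<eta>) = 0" using \<theta>_ker by blast
    then have prod: "ev_A n f [:var_X:] = ev_A n f \<xi> * ev_A n f \<eta>"
      by (simp add: ring_map_diff[OF ring_map_ev_A] ring_map_mult[OF ring_map_ev_A])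
    obtain m1 G1 q1 where 1: "[:var_X ^ m1:] * \<xi> = [:G1:] + q1 * rel_A n f" using ev_A_clear by blast
    obtain m2 G2 q2 where 2: "[:var_X ^ m2:] * \<eta> = [:G2:] + q2 * rel_A n f" using ev_A_clear by blast
    have ev1: "ev_A n f [:var_X ^ m1:] * ev_A n f \<xi> = laurent G1"
      using arg_cong[OF 1, of "ev_A n f"]
      by (simp only: ring_map_add[OF ring_map_ev_A] ring_map_mult[OF ring_map_ev_A] ev_A_rel ev_A_const) simp
    have ev2: "ev_A n f [:var_X ^ m2:] * ev_A n f \<eta> = laurent G2"
      using arg_cong[OF 2, of "ev_A n f"]
      by (simp only: ring_map_add[OF ring_map_ev_A] ring_map_mult[OF ring_map_ev_A] ev_A_rel ev_A_const) simp
    have "laurent (G1 * G2) = ev_A n f [:var_X ^ m1:] * ev_A n f [:var_X ^ m2:] * ev_A n f [:var_X:]"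
      unfolding ring_map_mult[OF ring_map_laurent] ev1[symmetric] ev2[symmetric] prod by (simp only: mult_ac)
    also have "\<dots> = laurent (var_X ^ m1 * var_X ^ m2 * var_X)"
      by (simp only: ev_A_const ring_map_mult[OF ring_map_laurent])
    finally have "laurent (G1 * G2 - var_X ^ (m1 + m2 + 1)) = 0"
      by (simp only: ring_map_diff[OF ring_map_laurent] power_add power_one_right) simp
    then have "G1 * G2 = var_X ^ (m1 + m2 + 1)" by (simp only: laurent_eq_0_iff right_minus_eq)
    then obtain \<beta> j where \<beta>: "\<beta> \<noteq> 0" "G1 = [:[:\<beta>:]:] * var_X ^ j" using monomial_factor by blast
    have "a ^ m1 * fls_X = \<theta> [:G1:]"
      using arg_cong[OF 1, of \<theta>]
      by (simp only: ring_map_add[OF \<theta>] ring_map_mult[OF \<theta>] \<theta>_rel a_pow \<xi>) simp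
    also have "[:G1:] = [:[:[:\<beta>:]:]:] * [:var_X ^ j:]" by (simp add: \<beta>)
    also have "\<theta> \<dots> = fls_const [:\<beta>:] * a ^ j" by (simp only: ring_map_mult[OF \<theta>] const a_pow)
    finally have eq: "a ^ m1 * fls_X = fls_const [:\<beta>:] * a ^ j" .
    define i where "i = fls_subdegree a"
    have "int m1 * i + 1 = int j * i"
      using arg_cong[OF eq, of fls_subdegree] a0 \<beta>(1)
      by (simp add: fls_subdegree_pow i_def fls_X_times_conv_shift(2))
    then have i1: "(int j - int m1) * i = 1" by (simp add: algebra_simps)
    then have "i dvd 1" by (metis dvd_triv_right)
    moreover have "i > 0"
      using c a0 True by (simp add: order_ge_iff i_def gen1)
    ultimately have i: "i = 1" by simp
    then have j: "j = Suc m1" using i1 by simp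
    have "a ^ m1 * fls_X = a ^ m1 * (fls_const [:\<beta>:] * a)"
      unfolding eq j by (simp add: mult_ac)
    then have x_eq: "fls_X = fls_const [:\<beta>:] * a"
      using a0 by simp
    have "lead_deg (fls_X :: 'k poly fls) = lead_deg (fls_const [:\<beta>:]) + lead_deg a"
      unfolding x_eq using \<beta>(1) a0 by (intro lead_deg_mult) auto
    then have lead_a: "lead_deg a = 0"
      using lead_const[OF \<beta>(1)] by (simp add: lead_deg_def)
    \<comment> \<open>A pole in \<open>B\<close> needs a factor \<open>y\<close> or
      \<open>t\<close>, so a pole of \<open>b\<close> would give \<open>lead_deg b \<ge> 2\<close>.
      As \<open>a\<close> has \<open>lead_deg\<close> 0, the nonzero elements of
      \<open>k[a, b]\<close> would have multiples of \<open>lead_deg b\<close>, contrary to the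
      value 1 at \<open>a ^ m * z\<close>.\<close>
    have ord_b: "order_ge b 0"
    proof (rule ccontr)
      assume neg: "\<not> order_ge b 0"
      then have b0: "b \<noteq> 0" by auto
      moreover from this have "fls_subdegree b < 0" using neg by (simp add: order_ge_iff)
      moreover have "b \<in> range ev_B" by (simp add: b_def \<theta>B)
      ultimately obtain i j k l :: nat where *:
        "int i - int k * int d - int l * int (d * degree Q + e) < 0"
        "lead_deg b = int j + int k * int (degree P) + int l * int (degree P * degree Q)"
        using ev_B_lead[of b] by auto
      have "k > 0 \<or> l > 0" using *(1) by (cases k; cases l) auto
      then have "2 \<le> k * degree P + l * (degree P * degree Q)"
        using P(2) Q(2) mult_le_mono[of 1 k 2 "degree P"] mult_le_mono[of 1 l 2 "degree P * degree Q"]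
          mult_le_mono[of 2 "degree P" 1 "degree Q"] by linarith
      then have "int 2 \<le> int (k * degree P + l * (degree P * degree Q))" by (rule of_nat_mono)
      then have ge2: "lead_deg b \<ge> 2" using *(2) by simp
      have coeff: "lead_deg (E [:C:]) = 0" if "C \<noteq> 0" for C
        using lead_polynomial_in_gen1[of c C] that a0 lead_a i by (auto simp: True gen1 i_def)
      have powers: "G \<noteq> 0 \<Longrightarrow> \<exists>i::nat. lead_deg (E G) = int i * lead_deg b" for G
      proof (induction G)
        case (pCons C G)
        have "pCons C G = [:C:] + [:0, 1:] * G" by simp
        then have eq: "E (pCons C G) = E [:C:] + b * E G"
          by (simp only: ring_map_add[OF E] ring_map_mult[OF E] E_b)
        show ?case
        proof (cases "G = 0")
          case True
          then show ?thesis using coeff pCons by (intro exI[of _ 0]) simp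
        next
          case False
          then obtain i :: nat where "lead_deg (E G) = int i * lead_deg b" using pCons by blast
          moreover have EG: "E G \<noteq> 0" using False inj by blast
          ultimately have bG: "lead_deg (b * E G) = int (Suc i) * lead_deg b"
            by (simp add: lead_deg_mult[OF b0] algebra_simps)
          show ?thesis
          proof (cases "C = 0")
            case True
            then have "E [:C:] = 0" by (simp add: ring_map_0[OF E])
            then show ?thesis unfolding eq using bG by (intro exI[of _ "Suc i"]) simp
          next
            case C: False
            have "lead_deg (b * E G) > 0" unfolding bG using ge2 by simp
            then have "lead_deg (E (pCons C G)) = 0 \<or> lead_deg (E (pCons C G)) = int (Suc i) * lead_deg b"
              using lead_add[of "E [:C:]" "b * E G"] coeff[OF C] b0 EG inj[of "[:C:]"] C
              unfolding eq bG[symmetric] by auto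
            then show ?thesis by (metis mult_zero_left of_nat_0)
          qed
        qed
      qed simp
      obtain m G where G: "gen1 ^ m * laurent [:0, 1:] = E G" using gen[OF B_laurent] by (metis imageE)
      have z: "laurent [:0, 1:] \<noteq> (0 :: 'k poly fls)" by simp
      have am: "a ^ m \<noteq> 0" using a0 by simp
      have "lead_deg (E G) = 1"
        unfolding G[symmetric] gen1 lead_deg_mult[OF am z] lead_deg_power[OF a0]
        by (simp only: lead_a lead_var_Z(3))
      moreover have "G \<noteq> 0" using G z am by (auto simp: gen1 ring_map_0[OF E])
      ultimately obtain i :: nat where "1 = int i * lead_deg b" using powers by metis
      then have "lead_deg b dvd 1" by (metis dvd_triv_right)
      then show False using ge2 by simp
    qed
    obtain G where "b = laurent G"
      using ev_B_order_ge[of b 0] ord_b \<theta>B by (auto simp: b_def)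
    moreover have v: "v \<in> range ev_B" by (simp add: v_def \<theta>B)
    ultimately have b: "b \<in> approx v" by (simp add: approx_laurent)
    have "a \<in> approx v" unfolding aX by (rule approx_X_mult[OF v B_laurent])
    from all_approx[OF v this b approx_var[OF v]] show ?thesis using approx_proper[OF ker v] by blast
  qed
qed

end

section \<open>Lifting isomorphisms of quotient algebras\<close>

lemma type_ring_simps:
  "carrier (ring_of_type_algebra :: 'a::comm_ring_1 ring) = UNIV"
  "x \<otimes>\<^bsub>ring_of_type_algebra\<^esub> y = (x * y :: 'a)" "x \<oplus>\<^bsub>ring_of_type_algebra\<^esub> y = (x + y :: 'a)"
  "\<one>\<^bsub>ring_of_type_algebra\<^esub> = (1 :: 'a)" "\<zero>\<^bsub>ring_of_type_algebra\<^esub> = (0 :: 'a)"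
  by (simp_all add: ring_of_type_algebra_def)

lemma type_ring_a_inv: "\<ominus>\<^bsub>ring_of_type_algebra\<^esub> (x :: 'a::comm_ring_1) = - x"
proof -
  interpret R: cring "ring_of_type_algebra :: 'a ring" by (rule cring_from_type_algebra)
  show ?thesis by (rule R.minus_equality) (simp_all add: type_ring_simps)
qed

lemma type_ring_minus: "x \<ominus>\<^bsub>ring_of_type_algebra\<^esub> y = (x :: 'a::comm_ring_1) - y"
  by (simp add: a_minus_def type_ring_a_inv type_ring_simps)

lemma ideal_type_ring_iff:
  "ideal I (ring_of_type_algebra :: 'a::comm_ring_1 ring) \<longleftrightarrow>
    0 \<in> I \<and> (\<forall>a\<in>I. \<forall>b\<in>I. a + b \<in> I) \<and> (\<forall>a. \<forall>x\<in>I. a * x \<in> I)"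
  (is "?l \<longleftrightarrow> ?r")
proof
  assume ?l
  then interpret ideal I "ring_of_type_algebra :: 'a ring" .
  show ?r
    using additive_subgroup.zero_closed[OF additive_subgroup_axioms]
      additive_subgroup.a_closed[OF additive_subgroup_axioms] I_l_closed
    by (simp add: type_ring_simps)
next
  assume r: ?r
  interpret R: cring "ring_of_type_algebra :: 'a ring" by (rule cring_from_type_algebra)
  show ?l
  proof (rule idealI)
    show "subgroup I (add_monoid (ring_of_type_algebra :: 'a ring))"
    proof (rule R.add.subgroupI)
      show "\<ominus>\<^bsub>ring_of_type_algebra\<^esub> a \<in> I" if "a \<in> I" for a
        using that r by (metis mult_minus1 type_ring_a_inv)
    qed (use r in \<open>auto simp: type_ring_simps\<close>)
    show "a \<otimes>\<^bsub>ring_of_type_algebra\<^esub> x \<in> I" if "a \<in> I" for a x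
      using that r by (metis type_ring_simps(2) mult.commute)
  qed (use r in \<open>auto simp: type_ring_simps intro: R.ring_axioms\<close>)
qed

definition gen_ideal :: "'a::comm_ring_1 set \<Rightarrow> 'a set" where
  "gen_ideal S = genideal ring_of_type_algebra S"

lemma ideal_gen_ideal: "ideal (gen_ideal S) (ring_of_type_algebra :: 'a::comm_ring_1 ring)"
proof -
  interpret R: cring "ring_of_type_algebra :: 'a ring" by (rule cring_from_type_algebra)
  show ?thesis unfolding gen_ideal_def by (rule R.genideal_ideal) (simp add: type_ring_simps)
qed

lemma gen_ideal_add: "a \<in> gen_ideal S \<Longrightarrow> b \<in> gen_ideal S \<Longrightarrow> a + b \<in> gen_ideal S"
  and gen_ideal_mult: "a \<in> gen_ideal S \<Longrightarrow> c * a \<in> gen_ideal S"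
  using ideal_gen_ideal[of S] unfolding ideal_type_ring_iff by auto

lemma gen_ideal_uminus: "a \<in> gen_ideal S \<Longrightarrow> - a \<in> gen_ideal S"
  using gen_ideal_mult[of a S "- 1"] by simp

lemma gen_ideal_diff: "a \<in> gen_ideal S \<Longrightarrow> b \<in> gen_ideal S \<Longrightarrow> a - b \<in> gen_ideal S"
  using gen_ideal_add[OF _ gen_ideal_uminus, of a S b] by simp

lemma gen_ideal_superset: "S \<subseteq> gen_ideal S"
proof -
  interpret R: cring "ring_of_type_algebra :: 'a ring" by (rule cring_from_type_algebra)
  show ?thesis unfolding gen_ideal_def by (rule R.genideal_self) (simp add: type_ring_simps)
qed

lemma gen_ideal_minimal:
  assumes "S \<subseteq> I" "0 \<in> I" "\<And>a b. a \<in> I \<Longrightarrow> b \<in> I \<Longrightarrow> a + b \<in> I" "\<And>c a. a \<in> I \<Longrightarrow> c * a \<in> I"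
  shows "gen_ideal S \<subseteq> I"
proof -
  interpret R: cring "ring_of_type_algebra :: 'a ring" by (rule cring_from_type_algebra)
  show ?thesis
    unfolding gen_ideal_def by (rule R.genideal_minimal) (use assms in \<open>auto simp: ideal_type_ring_iff\<close>)
qed

lemma gen_ideal_pair:
  assumes "p \<in> gen_ideal {a, b}"
  shows "\<exists>U W. p = U * a + W * b"
proof -
  have "gen_ideal {a, b} \<subseteq> {p. \<exists>U W. p = U * a + W * b}"
  proof (rule gen_ideal_minimal)
    show "{a, b} \<subseteq> {p. \<exists>U W. p = U * a + W * b}"
    proof -
      have "a = 1 * a + 0 * b" "b = 0 * a + 1 * b" by simp_all
      then show ?thesis by blast
    qed
    have "0 = 0 * a + 0 * b" by simp
    then show "0 \<in> {p. \<exists>U W. p = U * a + W * b}" by blast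
    show "x + y \<in> {p. \<exists>U W. p = U * a + W * b}"
      if xy: "x \<in> {p. \<exists>U W. p = U * a + W * b}" "y \<in> {p. \<exists>U W. p = U * a + W * b}" for x y
    proof -
      obtain U W U' W' where "x = U * a + W * b" "y = U' * a + W' * b" using xy by blast
      then have "x + y = (U + U') * a + (W + W') * b" by (simp add: algebra_simps)
      then show ?thesis by blast
    qed
    show "c * x \<in> {p. \<exists>U W. p = U * a + W * b}" if x: "x \<in> {p. \<exists>U W. p = U * a + W * b}" for c x
    proof -
      obtain U W where "x = U * a + W * b" using x by blast
      then have "c * x = (c * U) * a + (c * W) * b" by (simp add: algebra_simps)
      then show ?thesis by blast
    qed
  qed
  then show ?thesis using assms by blast
qed

text \<open>Representatives are chosen for the images of cosets, so \<open>\<Phi>\<close> respects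
  the operations only modulo the target ideal; an evaluation that kills this ideal will turn it into
  a homomorphism.\<close>

lemma quotient_algebra_iso_lift:
  fixes \<iota> :: "'k::field \<Rightarrow> 'a::comm_ring_1" and \<kappa> :: "'k \<Rightarrow> 'b::comm_ring_1"
  assumes "algebra_isomorphic (ring_of_type_algebra :: 'k ring) (quotient_algebra \<iota> S) (quotient_algebra \<kappa> S')"
  shows "\<exists>\<Phi> :: 'a \<Rightarrow> 'b.
    (\<forall>p q. \<Phi> (p + q) - (\<Phi> p + \<Phi> q) \<in> gen_ideal S') \<and>
    (\<forall>p q. \<Phi> (p * q) - \<Phi> p * \<Phi> q \<in> gen_ideal S') \<and>
    \<Phi> 1 - 1 \<in> gen_ideal S' \<and>
    (\<forall>c. \<Phi> (\<iota> c) - \<kappa> c \<in> gen_ideal S') \<and>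
    (\<forall>q. \<exists>p. \<Phi> p - q \<in> gen_ideal S') \<and>
    (\<forall>p. \<Phi> p \<in> gen_ideal S' \<longleftrightarrow> p \<in> gen_ideal S)"
proof -
  define R where "R = (ring_of_type_algebra :: 'a ring)"
  define R' where "R' = (ring_of_type_algebra :: 'b ring)"
  define I where "I = gen_ideal S"
  define J where "J = gen_ideal S'"
  interpret R: cring R unfolding R_def by (rule cring_from_type_algebra)
  interpret R': cring R' unfolding R'_def by (rule cring_from_type_algebra)
  interpret I: ideal I R unfolding I_def R_def by (rule ideal_gen_ideal)
  interpret J: ideal J R' unfolding J_def R'_def by (rule ideal_gen_ideal)
  interpret RI: cring "R Quot I" by (rule I.quotient_is_cring) (rule R.is_cring)
  interpret RJ: cring "R' Quot J" by (rule J.quotient_is_cring) (rule R'.is_cring)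
  define h where "h = (\<lambda>a. I +>\<^bsub>R\<^esub> a)"
  define g where "g = (\<lambda>a. J +>\<^bsub>R'\<^esub> a)"
  note simps = type_ring_simps[where 'a='a, folded R_def] type_ring_simps[where 'a='b, folded R'_def]
  have h: "h \<in> ring_hom R (R Quot I)" unfolding h_def by (rule I.rcos_ring_hom)
  have g: "g \<in> ring_hom R' (R' Quot J)" unfolding g_def by (rule J.rcos_ring_hom)
  have h_eq: "h p = h q \<longleftrightarrow> p - q \<in> I" for p q
    using R.quotient_eq_iff_same_a_r_cos[OF I.ideal_axioms, of p q]
    by (simp add: h_def simps type_ring_minus[where 'a='a, folded R_def])
  have g_eq: "g p = g q \<longleftrightarrow> p - q \<in> J" for p q
    using R'.quotient_eq_iff_same_a_r_cos[OF J.ideal_axioms, of p q]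
    by (simp add: g_def simps type_ring_minus[where 'a='b, folded R'_def])
  have carr: "carrier (R Quot I) = range h" "carrier (R' Quot J) = range g"
    by (auto simp: FactRing_def A_RCOSETS_def' simps h_def g_def)
  obtain \<phi> where \<phi>: "\<phi> \<in> algebra_iso (ring_of_type_algebra :: 'k ring) (quotient_algebra \<iota> S) (quotient_algebra \<kappa> S')"
    using assms by (auto simp: algebra_isomorphic_def)
  let ?A = "quotient_algebra \<iota> S" and ?B = "quotient_algebra \<kappa> S'"
  have A: "carrier ?A = range h" "x \<otimes>\<^bsub>?A\<^esub> y = x \<otimes>\<^bsub>R Quot I\<^esub> y" "x \<oplus>\<^bsub>?A\<^esub> y = x \<oplus>\<^bsub>R Quot I\<^esub> y"
    "\<one>\<^bsub>?A\<^esub> = \<one>\<^bsub>R Quot I\<^esub>" "c \<odot>\<^bsub>?A\<^esub> x = h (\<iota> c) \<otimes>\<^bsub>R Quot I\<^esub> x" for x y c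
    by (simp_all add: quotient_algebra_def Let_def carr flip: R_def)
      (simp_all add: I_def gen_ideal_def R_def h_def carr[unfolded I_def gen_ideal_def R_def h_def])
  have B: "carrier ?B = range g" "x \<otimes>\<^bsub>?B\<^esub> y = x \<otimes>\<^bsub>R' Quot J\<^esub> y" "x \<oplus>\<^bsub>?B\<^esub> y = x \<oplus>\<^bsub>R' Quot J\<^esub> y"
    "\<one>\<^bsub>?B\<^esub> = \<one>\<^bsub>R' Quot J\<^esub>" "c \<odot>\<^bsub>?B\<^esub> x = g (\<kappa> c) \<otimes>\<^bsub>R' Quot J\<^esub> x" for x y c
    by (simp_all add: quotient_algebra_def Let_def carr flip: R'_def)
      (simp_all add: J_def gen_ideal_def R'_def g_def carr[unfolded J_def gen_ideal_def R'_def g_def])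
  have hc: "h p \<in> carrier ?A" for p by (simp add: A)
  have hom: "\<phi> \<in> ring_hom ?A ?B" and bij: "bij_betw \<phi> (range h) (range g)"
    and lin: "\<phi> (c \<odot>\<^bsub>?A\<^esub> h p) = c \<odot>\<^bsub>?B\<^esub> \<phi> (h p)" for c p
    using \<phi> hc by (auto simp: algebra_iso_def ring_iso_def A(1) B(1) type_ring_simps)
  define \<Phi> where "\<Phi> p = (SOME q. \<phi> (h p) = g q)" for p
  have \<Phi>: "\<phi> (h p) = g (\<Phi> p)" for p
  proof -
    have "\<phi> (h p) \<in> range g" using bij_betw_apply[OF bij] by blast
    then have "\<exists>q. \<phi> (h p) = g q" by blast
    then show ?thesis unfolding \<Phi>_def by (rule someI_ex)
  qed
  have h_ops: "h (p + q) = h p \<oplus>\<^bsub>R Quot I\<^esub> h q" "h (p * q) = h p \<otimes>\<^bsub>R Quot I\<^esub> h q" "h 1 = \<one>\<^bsub>R Quot I\<^esub>" for p q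
    using ring_hom_add[OF h, of p q] ring_hom_mult[OF h, of p q] ring_hom_one[OF h] by (simp_all add: simps)
  have g_ops: "g (p + q) = g p \<oplus>\<^bsub>R' Quot J\<^esub> g q" "g (p * q) = g p \<otimes>\<^bsub>R' Quot J\<^esub> g q" "g 1 = \<one>\<^bsub>R' Quot J\<^esub>" for p q
    using ring_hom_add[OF g, of p q] ring_hom_mult[OF g, of p q] ring_hom_one[OF g] by (simp_all add: simps)
  have add: "g (\<Phi> (p + q)) = g (\<Phi> p + \<Phi> q)" for p q
    using ring_hom_add[OF hom hc hc, of p q] by (simp add: A B h_ops g_ops flip: \<Phi>)
  moreover have "g (\<Phi> (p * q)) = g (\<Phi> p * \<Phi> q)" for p q
    using ring_hom_mult[OF hom hc hc, of p q] by (simp add: A B h_ops g_ops flip: \<Phi>)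
  moreover have one: "g (\<Phi> 1) = g 1"
    using ring_hom_one[OF hom] by (simp add: A B h_ops g_ops flip: \<Phi>)
  moreover have "g (\<Phi> (\<iota> c)) = g (\<kappa> c)" for c
  proof -
    have "g (\<Phi> (\<iota> c)) = \<phi> (c \<odot>\<^bsub>?A\<^esub> h 1)" by (simp add: A flip: \<Phi> h_ops(2))
    also have "\<dots> = g (\<kappa> c)" unfolding lin \<Phi> one by (simp add: B flip: g_ops(2))
    finally show ?thesis .
  qed
  moreover have "\<exists>p. g (\<Phi> p) = g q" for q
  proof -
    have "g q \<in> \<phi> ` range h" using bij by (auto simp: bij_betw_def)
    then show ?thesis using \<Phi> by auto
  qed
  moreover have "g (\<Phi> p) = g 0 \<longleftrightarrow> h p = h 0" for p
  proof -
    have "g (\<Phi> 0) = g 0"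
      using add[of 0 0] gen_ideal_uminus[of "- \<Phi> 0" S'] by (simp add: g_eq J_def)
    then have "g (\<Phi> p) = g 0 \<longleftrightarrow> \<phi> (h p) = \<phi> (h 0)" by (simp add: \<Phi>)
    also have "\<dots> \<longleftrightarrow> h p = h 0" using bij by (auto simp: bij_betw_def inj_on_def)
    finally show ?thesis .
  qed
  ultimately show ?thesis
    unfolding I_def[symmetric] J_def[symmetric] g_eq h_eq by (intro exI[of _ \<Phi>]) simp
qed

section \<open>From an abstract isomorphism to rings of Laurent series\<close>

context double_danielewski
begin

lemma isomorphism_impossible:
  assumes f: "at_X_0 f \<noteq> 0"
    and iso: "algebra_isomorphic (ring_of_type_algebra :: 'k ring)
      (danielewski_algebra n f) (double_danielewski_algebra d e P Q)"
  shows False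
proof -
  define I where "I = gen_ideal {rel_A n f}"
  define J where "J = gen_ideal {rel1, rel2}"
  obtain \<Phi> where \<Phi>: "\<And>p q. \<Phi> (p + q) - (\<Phi> p + \<Phi> q) \<in> J" "\<And>p q. \<Phi> (p * q) - \<Phi> p * \<Phi> q \<in> J"
    "\<Phi> 1 - 1 \<in> J" "\<And>c. \<Phi> [:[:[:c:]:]:] - [:[:[:[:c:]:]:]:] \<in> J" "\<And>q. \<exists>p. \<Phi> p - q \<in> J"
    "\<And>p. \<Phi> p \<in> J \<longleftrightarrow> p \<in> I"
    using quotient_algebra_iso_lift[OF iso[unfolded danielewski_algebra_def double_danielewski_algebra_def]]
    unfolding I_def J_def rel_A_def rel1_def rel2_def by blast
  have evJ: "ev_B p = 0" if p: "p \<in> J" for p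
  proof -
    obtain U W where "p = U * rel1 + W * rel2" using p gen_ideal_pair unfolding J_def by blast
    then show ?thesis by (simp add: ev_B_simps ev_B_rel)
  qed
  then have ev_eq: "ev_B p = ev_B q" if "p - q \<in> J" for p q
    using that evJ[of "p - q"] by (simp add: ev_B_simps)
  have I_iff: "p \<in> I \<longleftrightarrow> ev_A n f p = 0" for p
  proof
    assume p: "p \<in> I"
    have "{rel_A n f} = {rel_A n f, rel_A n f}" by simp
    then obtain U W where "p = U * rel_A n f + W * rel_A n f"
      using p gen_ideal_pair unfolding I_def by metis
    then show "ev_A n f p = 0"
      by (simp add: ring_map_add[OF ring_map_ev_A] ring_map_mult[OF ring_map_ev_A] ev_A_rel)
  next
    assume "ev_A n f p = 0"
    then obtain q where "p = q * rel_A n f" using ev_A_kernel[OF f] by blast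
    then show "p \<in> I"
      unfolding I_def using gen_ideal_mult gen_ideal_superset by blast
  qed
  have rels: "rel1 \<in> J" "rel2 \<in> J" unfolding J_def using gen_ideal_superset by blast+
  obtain \<xi> where \<xi>: "\<Phi> \<xi> - [:[:var_X:]:] \<in> J" using \<Phi>(5) by blast
  have \<xi>_nz: "ev_A n f \<xi> \<noteq> 0"
  proof
    assume "ev_A n f \<xi> = 0"
    then have "ev_B (\<Phi> \<xi>) = 0" using I_iff \<Phi>(6) evJ by blast
    then show False using ev_eq[OF \<xi>] by (simp add: ev_B_var_X)
  qed
  \<comment> \<open>The class of \<open>\<xi>\<close> in \<open>A\<close> corresponds to
    \<open>x\<close> and is nonzero in a domain, so multiplication by \<open>x\<close> is injective
    modulo \<open>J\<close>. Each step of the induction trades one factor \<open>x\<close> for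
    \<open>\<xi>\<close>.\<close>
  have torsion_free: "ev_A n f p = 0" if "[:[:var_X ^ m:]:] * \<Phi> p \<in> J" for m p
    using that
  proof (induction m arbitrary: p)
    case 0
    then show ?case using I_iff \<Phi>(6) by (simp add: one_pCons[symmetric])
  next
    case (Suc m)
    define x :: "'k poly poly poly poly" where "x = [:[:var_X:]:]"
    define y :: "'k poly poly poly poly" where "y = [:[:var_X ^ m:]:]"
    have xy: "[:[:var_X ^ Suc m:]:] = y * x" by (simp add: x_def y_def mult.commute)
    have "y * \<Phi> (\<xi> * p) = y * x * \<Phi> p + y * (\<Phi> (\<xi> * p) - \<Phi> \<xi> * \<Phi> p) + (y * \<Phi> p) * (\<Phi> \<xi> - x)"
      by (simp only: algebra_simps)
    also have "\<dots> \<in> J"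
      using Suc.prems gen_ideal_mult[OF \<Phi>(2)[of \<xi> p, unfolded J_def], of y]
        gen_ideal_mult[OF \<xi>[unfolded J_def], of "y * \<Phi> p"]
      unfolding J_def xy x_def[symmetric] by (intro gen_ideal_add)
    finally have "ev_A n f (\<xi> * p) = 0" using Suc.IH by (simp only: y_def)
    then show ?case using \<xi>_nz by (simp add: ring_map_mult[OF ring_map_ev_A])
  qed
  \<comment> \<open>An element killed by \<open>ev_B\<close> is \<open>x\<close>-torsion modulo
    \<open>J\<close>: after multiplication by a power of \<open>x\<close> it is congruent to some
    \<open>G\<close> in \<open>k[X, Z]\<close>, on which the evaluation is injective.\<close>
  have \<theta>_ker: "ev_B (\<Phi> p) = 0 \<longleftrightarrow> ev_A n f p = 0" for p
  proof
    assume 0: "ev_B (\<Phi> p) = 0"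
    obtain m G U W where eq: "[:[:var_X ^ m:]:] * \<Phi> p = [:[:G:]:] + U * rel1 + W * rel2"
      using ev_B_clear by blast
    from arg_cong[OF this, of ev_B] have "laurent G = 0"
      by (simp add: ring_map_add[OF T.ring_map_ev] ring_map_mult[OF T.ring_map_ev] ev_B_rel
          ev_B_polynomial 0 del: mult_pCons_left mult_pCons_right)
    then have "[:[:var_X ^ m:]:] * \<Phi> p = U * rel1 + W * rel2" using eq by simp
    then have "[:[:var_X ^ m:]:] * \<Phi> p \<in> J"
      using rels unfolding J_def by (simp only: gen_ideal_add gen_ideal_mult)
    then show "ev_A n f p = 0" by (rule torsion_free)
  qed (use I_iff \<Phi>(6) evJ in blast)
  show False
  proof (rule no_isomorphism)
    show "ring_map (\<lambda>p. ev_B (\<Phi> p))"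
      using ev_eq[OF \<Phi>(1)] ev_eq[OF \<Phi>(2)] ev_eq[OF \<Phi>(3)] by (simp add: ring_map_def ev_B_simps)
    show "ev_B (\<Phi> [:[:[:c:]:]:]) = fls_const [:c:]" for c
      using ev_eq[OF \<Phi>(4)] by (simp add: ev_B_polynomial laurent_const)
    show "range (\<lambda>p. ev_B (\<Phi> p)) = range ev_B"
    proof
      show "range ev_B \<subseteq> range (\<lambda>p. ev_B (\<Phi> p))"
      proof
        fix y assume "y \<in> range ev_B"
        then obtain q where "y = ev_B q" by blast
        moreover obtain p where "\<Phi> p - q \<in> J" using \<Phi>(5) by blast
        ultimately have "y = ev_B (\<Phi> p)" using ev_eq by simp
        then show "y \<in> range (\<lambda>p. ev_B (\<Phi> p))" by blast
      qed
    qed auto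
    show "ev_B (\<Phi> p) = 0 \<longleftrightarrow> ev_A n f p = 0" for p by (rule \<theta>_ker)
    show "\<exists>U W. q = U * rel1 + W * rel2" if q: "ev_B q = 0" for q
    proof -
      obtain p where p: "\<Phi> p - q \<in> J" using \<Phi>(5) by blast
      then have "ev_B (\<Phi> p) = 0" using ev_eq q by simp
      then have "\<Phi> p \<in> J" using \<theta>_ker I_iff \<Phi>(6) by blast
      then have "\<Phi> p - (\<Phi> p - q) \<in> J" using p unfolding J_def by (rule gen_ideal_diff)
      then show ?thesis using gen_ideal_pair unfolding J_def by simp
    qed
  qed
qed

end

theorem corollary3p11:
  fixes f P :: "'k::field poly poly" and Q :: "'k poly poly poly" and n d e :: nat
  assumes "n \<ge> 2" and "Polynomial.degree f \<ge> 2" and "at_X_0 f \<noteq> 0"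
    and "d > 0" and "e > 0"
    and "lead_coeff P = 1" and "Polynomial.degree P \<ge> 2"
    and "lead_coeff Q = 1" and "Polynomial.degree Q \<ge> 2"
  shows "\<not> algebra_isomorphic (ring_of_type_algebra :: 'k ring)
      (danielewski_algebra n f) (double_danielewski_algebra d e P Q)"
proof -
  interpret double_danielewski P Q d e
    using assms by unfold_locales auto
  show ?thesis using isomorphism_impossible[OF assms(3)] by blast
qed

end
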